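(* The representations $\pi_\nu$ and $\oplus_{n\in\mathbb N}\lambda_n$ of $G$ are weakly equivalent, where $\nu=(\nu_n)_{n\in\mathbb N}$, $\nu_n=|G/G_n|$, is the maximal growth function.
   Context: Let $G$ be a residually finite (discrete) group with normal subgroups of finite index $G\supset G_1\supset G_2\supset\cdots$, strictly decreasing, such that $\cap_{n\in\mathbb N}G_n=\{e\}$. Put $X_n=G/G_n$ (a finite group on which $G$ acts by left translation, $(g,x)\mapsto gx$) and $\nu_n=|X_n|$; thus $\nu_{n+1}/\nu_n\ge 2$. Let $l^2(X_n)$ be the finite-dimensional Hilbert space with respect to counting measure on $X_n$, and let $\lambda_n$ be the quasi-regular representation of $G$ on $l^2(X_n)$, $(\lambda_n(g)\xi)(x)=\xi(g^{-1}x)$. Fix a non-principal ultrafilter $\mathcal U$ on $\mathbb N$. Let $\widetilde H=\{\xi=(\xi_n)_{n\in\mathbb N}:\xi_n\in l^2(X_n),\ \sup_n\|\xi_n\|<\infty\}$ with the sesquilinear form $\langle\xi,\eta\rangle=\lim_{\mathcal U}\langle\xi_n,\eta_n\rangle$, let $\widetilde H_0=\{\xi\in\widetilde H:\langle\xi,\xi\rangle=0\}$, and let $\widehat H$ be the Hilbert space completion of $\widetilde H/\widetilde H_0$. The formula $\widehat\lambda(g)(\xi_n)_{n}=(\lambda_n(g)\xi_n)_{n}$, $g\in G$, defines a unitary representation $\widehat\lambda$ of $G$ on $\widehat H$. Let $Z$ be the set of all non-decreasing integer-valued sequences $\gamma=(\gamma_n)_{n\in\mathbb N}$ with $1\le\gamma_n\le\nu_n$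 for all $n$ (growth functions). For $\gamma\in Z$ and $k\in\mathbb N$ let $\widetilde H^{(k)}_\gamma\subset\widetilde H$ be the set of all sequences $(\xi_n)$ with $|\operatorname{supp}\xi_n|\le k\gamma_n$ for each $n$; let $\widetilde H_\gamma=\cup_{k=1}^\infty\widetilde H^{(k)}_\gamma$ (a linear subspace), and let $H_\gamma$ be the closure of $(\widetilde H_\gamma+\widetilde H_0)/\widetilde H_0$ in $\widehat H$. The subspace $H_\gamma$ is invariant under $\widehat\lambda$, and $\pi_\gamma=\widehat\lambda|_{H_\gamma}$. Representations of $G$ are extended linearly to $\mathbb C[G]$. A unitary representation $\pi$ is weakly contained in $\sigma$ if $\|\pi(a)\|\le\|\sigma(a)\|$ for all $a\in\mathbb C[G]$; $\pi$ and $\sigma$ are weakly equivalent if each is weakly contained in the other, i.e. $\|\pi(a)\|=\|\sigma(a)\|$ for all $a\in\mathbb C[G]$. *)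

theory Defs
  imports Complex_Main "HOL-Algebra.AbelCoset" "HOL-Algebra.Module"
begin

section \<open>Complex (semi-)inner product spaces and their completions\<close>

text \<open>
  Spaces are carrier-based, since the spaces constructed below depend on the ultrafilter.
  They extend the modules of HOL-Algebra by a sesquilinear form, linear in the first argument.
  The ring fields \<open>mult\<close> and \<open>one\<close> inherited by the record are irrelevant and left undefined.
\<close>

record 'v ip_space = "(complex, 'v) module" +
  iprod :: "'v \<Rightarrow> 'v \<Rightarrow> complex"

definition vnorm :: "'v ip_space \<Rightarrow> 'v \<Rightarrow> real" where
  "vnorm V x = sqrt (Re (iprod V x x))"

definition opnorm :: "'v ip_space \<Rightarrow> ('v \<Rightarrow> 'v) \<Rightarrow> real" where
  "opnorm V T = (SUP x \<in> {x \<in> carrier V. vnorm V x \<le> 1}. vnorm V (T x))"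

definition norm_closure :: "'v ip_space \<Rightarrow> 'v set \<Rightarrow> 'v set" where
  "norm_closure V S =
     {x \<in> carrier V. \<forall>\<epsilon>>0. \<exists>y\<in>S. vnorm V (x \<ominus>\<^bsub>V\<^esub> y) < \<epsilon>}"

definition null_space :: "'v ip_space \<Rightarrow> 'v set" where
  "null_space V = {x \<in> carrier V. iprod V x x = 0}"

definition null_class :: "'v ip_space \<Rightarrow> 'v \<Rightarrow> 'v set" where
  "null_class V x = null_space V +>\<^bsub>V\<^esub> x"

text \<open>
  The quotient of a semi-inner product space by its null space.  The unions range over all
  representatives; they are unions of equal sets, as the operations respect the null space.
\<close>

definition separation :: "'v ip_space \<Rightarrow> 'v set ip_space" where
  "separation V =
     \<lparr>carrier = a_rcosets\<^bsub>V\<^esub> (null_space V), mult = undefined, one = undefined,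
      zero = null_space V,
      add = (\<lambda>X Y. X <+>\<^bsub>V\<^esub> Y),
      smult = (\<lambda>c X. \<Union>x\<in>X. null_class V (c \<odot>\<^bsub>V\<^esub> x)),
      iprod = (\<lambda>X Y. the_elem (\<Union>x\<in>X. \<Union>y\<in>Y. {iprod V x y}))\<rparr>"

definition separation_map :: "'v ip_space \<Rightarrow> ('v \<Rightarrow> 'v) \<Rightarrow> 'v set \<Rightarrow> 'v set" where
  "separation_map V T X = (\<Union>x\<in>X. null_class V (T x))"

definition seq_space ::
  "(nat \<Rightarrow> 'v ip_space) \<Rightarrow> (nat \<Rightarrow> 'v) set \<Rightarrow> ((nat \<Rightarrow> 'v) \<Rightarrow> (nat \<Rightarrow> 'v) \<Rightarrow> complex)
     \<Rightarrow> (nat \<Rightarrow> 'v) ip_space" where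
  "seq_space V S form =
     \<lparr>carrier = S, mult = undefined, one = undefined,
      zero = (\<lambda>n. \<zero>\<^bsub>V n\<^esub>),
      add = (\<lambda>s t n. s n \<oplus>\<^bsub>V n\<^esub> t n),
      smult = (\<lambda>c s n. c \<odot>\<^bsub>V n\<^esub> s n),
      iprod = form\<rparr>"

definition cauchy_seqs :: "'v ip_space \<Rightarrow> (nat \<Rightarrow> 'v) set" where
  "cauchy_seqs V = {s. (\<forall>k. s k \<in> carrier V) \<and>
     (\<forall>\<epsilon>>0. \<exists>M. \<forall>k\<ge>M. \<forall>l\<ge>M. vnorm V (s k \<ominus>\<^bsub>V\<^esub> s l) < \<epsilon>)}"

definition cauchy_space :: "'v ip_space \<Rightarrow> (nat \<Rightarrow> 'v) ip_space" where
  "cauchy_space V =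
     seq_space (\<lambda>_. V) (cauchy_seqs V) (\<lambda>s t. lim (\<lambda>k. iprod V (s k) (t k)))"

text \<open>The completion consists of the Cauchy sequences modulo those of limit norm 0.\<close>

definition completion :: "'v ip_space \<Rightarrow> (nat \<Rightarrow> 'v) set ip_space" where
  "completion V = separation (cauchy_space V)"

definition completion_embed :: "'v ip_space \<Rightarrow> 'v \<Rightarrow> (nat \<Rightarrow> 'v) set" where
  "completion_embed V x = null_class (cauchy_space V) (\<lambda>_. x)"

text \<open>For bounded linear \<open>T\<close> this is the continuous extension of \<open>T\<close> to the completion.\<close>

definition completion_map ::
  "'v ip_space \<Rightarrow> ('v \<Rightarrow> 'v) \<Rightarrow> (nat \<Rightarrow> 'v) set \<Rightarrow> (nat \<Rightarrow> 'v) set" where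
  "completion_map V T = separation_map (cauchy_space V) (\<lambda>s k. T (s k))"


section \<open>Representations and weak containment\<close>

record ('g, 'v) rep =
  rep_space :: "'v ip_space"
  rep_act :: "'g \<Rightarrow> 'v \<Rightarrow> 'v"

definition group_algebra :: "('g, 'b) monoid_scheme \<Rightarrow> ('g \<Rightarrow> complex) set" where
  "group_algebra G = {a. finite {g. a g \<noteq> 0} \<and> {g. a g \<noteq> 0} \<subseteq> carrier G}"

definition rep_ext :: "('g, 'v) rep \<Rightarrow> ('g \<Rightarrow> complex) \<Rightarrow> 'v \<Rightarrow> 'v" where
  "rep_ext \<pi> a v =
     finsum (rep_space \<pi>) (\<lambda>g. a g \<odot>\<^bsub>rep_space \<pi>\<^esub> rep_act \<pi> g v) {g. a g \<noteq> 0}"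

definition weakly_contained ::
  "('g, 'b) monoid_scheme \<Rightarrow> ('g, 'v) rep \<Rightarrow> ('g, 'w) rep \<Rightarrow> bool" where
  "weakly_contained G \<pi> \<sigma> \<longleftrightarrow>
     (\<forall>a \<in> group_algebra G.
        opnorm (rep_space \<pi>) (rep_ext \<pi> a) \<le> opnorm (rep_space \<sigma>) (rep_ext \<sigma> a))"

definition weakly_equivalent ::
  "('g, 'b) monoid_scheme \<Rightarrow> ('g, 'v) rep \<Rightarrow> ('g, 'w) rep \<Rightarrow> bool" where
  "weakly_equivalent G \<pi> \<sigma> \<longleftrightarrow> weakly_contained G \<pi> \<sigma> \<and> weakly_contained G \<sigma> \<pi>"

text \<open>The Hilbert space direct sum: square-summable sequences.\<close>

definition direct_sum_space :: "(nat \<Rightarrow> 'v ip_space) \<Rightarrow> (nat \<Rightarrow> 'v) ip_space" where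
  "direct_sum_space V =
     seq_space V
       {\<xi>. (\<forall>n. \<xi> n \<in> carrier (V n)) \<and> summable (\<lambda>n. (vnorm (V n) (\<xi> n))\<^sup>2)}
       (\<lambda>\<xi> \<eta>. \<Sum>n. iprod (V n) (\<xi> n) (\<eta> n))"

definition direct_sum_rep :: "(nat \<Rightarrow> ('g, 'v) rep) \<Rightarrow> ('g, nat \<Rightarrow> 'v) rep" where
  "direct_sum_rep \<rho> =
     \<lparr>rep_space = direct_sum_space (\<lambda>n. rep_space (\<rho> n)),
      rep_act = (\<lambda>g \<xi> n. rep_act (\<rho> n) g (\<xi> n))\<rparr>"


section \<open>Ultraproducts of Hilbert spaces\<close>

definition nonprincipal_ultrafilter :: "nat filter \<Rightarrow> bool" where
  "nonprincipal_ultrafilter \<U> \<longleftrightarrow>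
     \<U> \<noteq> bot \<and>
     (\<forall>P. eventually P \<U> \<or> eventually (\<lambda>n. \<not> P n) \<U>) \<and>
     (\<forall>m. \<not> eventually (\<lambda>n. n = m) \<U>)"

text \<open>Bounded sequences, with the form given by the limit along \<open>\<U>\<close>.\<close>

definition bounded_space :: "nat filter \<Rightarrow> (nat \<Rightarrow> 'v ip_space) \<Rightarrow> (nat \<Rightarrow> 'v) ip_space" where
  "bounded_space \<U> V =
     seq_space V
       {\<xi>. (\<forall>n. \<xi> n \<in> carrier (V n)) \<and> bdd_above (range (\<lambda>n. vnorm (V n) (\<xi> n)))}
       (\<lambda>\<xi> \<eta>. Lim \<U> (\<lambda>n. iprod (V n) (\<xi> n) (\<eta> n)))"


section \<open>Quasi-regular representations\<close>

text \<open>
  \<open>N\<close> is meant to be normal, so that the right cosets \<open>rcosets N\<close>, which are the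
  elements of \<open>G Mod N\<close>, are also the left cosets, and \<open>G\<close> acts on them by left translation.
  Vectors are functions on all sets that vanish off the finite set \<open>rcosets N\<close>.
\<close>

definition l2 :: "'x set \<Rightarrow> ('x \<Rightarrow> complex) ip_space" where
  "l2 X =
     \<lparr>carrier = {\<xi>. \<forall>x. x \<notin> X \<longrightarrow> \<xi> x = 0}, mult = undefined, one = undefined,
      zero = (\<lambda>_. 0),
      add = (\<lambda>\<xi> \<eta> x. \<xi> x + \<eta> x),
      smult = (\<lambda>c \<xi> x. c * \<xi> x),
      iprod = (\<lambda>\<xi> \<eta>. \<Sum>x\<in>X. \<xi> x * cnj (\<eta> x))\<rparr>"

definition quasi_regular ::
  "('g, 'b) monoid_scheme \<Rightarrow> 'g set \<Rightarrow> ('g, 'g set \<Rightarrow> complex) rep" where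
  "quasi_regular G N =
     \<lparr>rep_space = l2 (carrier (G Mod N)),
      rep_act = (\<lambda>g \<xi> x. if x \<in> carrier (G Mod N) then \<xi> (inv\<^bsub>G\<^esub> g <#\<^bsub>G\<^esub> x) else 0)\<rparr>"


section \<open>The representations attached to growth functions\<close>

definition nu :: "('g, 'b) monoid_scheme \<Rightarrow> (nat \<Rightarrow> 'g set) \<Rightarrow> nat \<Rightarrow> nat" where
  "nu G N n = card (carrier (G Mod N n))"

definition growth_functions :: "('g, 'b) monoid_scheme \<Rightarrow> (nat \<Rightarrow> 'g set) \<Rightarrow> (nat \<Rightarrow> nat) set" where
  "growth_functions G N = {\<gamma>. mono \<gamma> \<and> (\<forall>n. 1 \<le> \<gamma> n \<and> \<gamma> n \<le> nu G N n)}"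

lemma nu_greatest_growth_function:
  assumes "group G" and "\<And>n. N n \<lhd> G" and fin: "\<And>n. finite (carrier (G Mod N n))"
    and dec: "\<And>n. N (Suc n) \<subset> N n"
  shows "nu G N \<in> growth_functions G N"
    and "\<gamma> \<in> growth_functions G N \<Longrightarrow> \<gamma> n \<le> nu G N n"
proof -
  interpret group G by fact
  have sub: "subgroup (N n) G" for n
    using assms(2) normal_imp_subgroup by blast
  have "nu G N n \<le> nu G N (Suc n)" for n
  proof -
    have "N n <#>\<^bsub>G\<^esub> N (Suc n) \<subseteq> N n"
      using dec[of n] sub[of n]
      by (auto simp: set_mult_def dest: subgroup.m_closed)
    moreover have "N n \<subseteq> N n <#>\<^bsub>G\<^esub> N (Suc n)"
    proof
      fix x assume "x \<in> N n"
      then have "x = x \<otimes>\<^bsub>G\<^esub> \<one>\<^bsub>G\<^esub>" using subgroup.mem_carrier[OF sub] by simp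
      then show "x \<in> N n <#>\<^bsub>G\<^esub> N (Suc n)"
        using \<open>x \<in> N n\<close> subgroup.one_closed[OF sub[of "Suc n"]] unfolding set_mult_def by blast
    qed
    ultimately have eq: "N n <#>\<^bsub>G\<^esub> N (Suc n) = N n" by blast
    have "carrier (G Mod N n) \<subseteq> (\<lambda>C. N n <#>\<^bsub>G\<^esub> C) ` carrier (G Mod N (Suc n))"
    proof
      fix X assume "X \<in> carrier (G Mod N n)"
      then obtain x where x: "x \<in> carrier G" "X = N n #>\<^bsub>G\<^esub> x"
        by (auto simp: FactGroup_def RCOSETS_def)
      have "N n <#>\<^bsub>G\<^esub> (N (Suc n) #>\<^bsub>G\<^esub> x) = X"
        using setmult_rcos_assoc[OF subgroup.subset[OF sub[of n]] subgroup.subset[OF sub[of "Suc n"]] x(1)]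
        by (simp add: eq x(2))
      moreover have "N (Suc n) #>\<^bsub>G\<^esub> x \<in> carrier (G Mod N (Suc n))"
        using x by (auto simp: FactGroup_def RCOSETS_def)
      ultimately show "X \<in> (\<lambda>C. N n <#>\<^bsub>G\<^esub> C) ` carrier (G Mod N (Suc n))" by blast
    qed
    then show ?thesis unfolding nu_def using fin by (meson surj_card_le)
  qed
  then have "mono (nu G N)" by (simp add: mono_iff_le_Suc)
  moreover have "1 \<le> nu G N n" for n
  proof -
    have "carrier (G Mod N n) \<noteq> {}" by (auto simp: FactGroup_def RCOSETS_def)
    then show ?thesis unfolding nu_def using fin by (simp add: Suc_le_eq card_gt_0_iff)
  qed
  ultimately show "nu G N \<in> growth_functions G N" by (auto simp: growth_functions_def)
qed (auto simp: growth_functions_def)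

definition H_tilde ::
  "nat filter \<Rightarrow> ('g, 'b) monoid_scheme \<Rightarrow> (nat \<Rightarrow> 'g set) \<Rightarrow> (nat \<Rightarrow> 'g set \<Rightarrow> complex) ip_space"
  where
  "H_tilde \<U> G N = bounded_space \<U> (\<lambda>n. l2 (carrier (G Mod N n)))"

definition H_hat ::
  "nat filter \<Rightarrow> ('g, 'b) monoid_scheme \<Rightarrow> (nat \<Rightarrow> 'g set)
     \<Rightarrow> (nat \<Rightarrow> (nat \<Rightarrow> 'g set \<Rightarrow> complex) set) set ip_space" where
  "H_hat \<U> G N = completion (separation (H_tilde \<U> G N))"

definition lambda_hat ::
  "nat filter \<Rightarrow> ('g, 'b) monoid_scheme \<Rightarrow> (nat \<Rightarrow> 'g set)
     \<Rightarrow> 'g \<Rightarrow> (nat \<Rightarrow> (nat \<Rightarrow> 'g set \<Rightarrow> complex) set) set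
     \<Rightarrow> (nat \<Rightarrow> (nat \<Rightarrow> 'g set \<Rightarrow> complex) set) set" where
  "lambda_hat \<U> G N g =
     completion_map (separation (H_tilde \<U> G N))
       (separation_map (H_tilde \<U> G N) (\<lambda>\<xi> n. rep_act (quasi_regular G (N n)) g (\<xi> n)))"

definition H_tilde_gamma ::
  "nat filter \<Rightarrow> ('g, 'b) monoid_scheme \<Rightarrow> (nat \<Rightarrow> 'g set) \<Rightarrow> (nat \<Rightarrow> nat)
     \<Rightarrow> (nat \<Rightarrow> 'g set \<Rightarrow> complex) set" where
  "H_tilde_gamma \<U> G N \<gamma> =
     (\<Union>k\<in>{1..}. {\<xi> \<in> carrier (H_tilde \<U> G N). \<forall>n. card {x. \<xi> n x \<noteq> 0} \<le> k * \<gamma> n})"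

definition H_gamma ::
  "nat filter \<Rightarrow> ('g, 'b) monoid_scheme \<Rightarrow> (nat \<Rightarrow> 'g set) \<Rightarrow> (nat \<Rightarrow> nat)
     \<Rightarrow> (nat \<Rightarrow> (nat \<Rightarrow> 'g set \<Rightarrow> complex) set) set set" where
  "H_gamma \<U> G N \<gamma> =
     norm_closure (H_hat \<U> G N)
       ((\<lambda>\<xi>. completion_embed (separation (H_tilde \<U> G N)) (null_class (H_tilde \<U> G N) \<xi>)) `
          (H_tilde_gamma \<U> G N \<gamma> <+>\<^bsub>H_tilde \<U> G N\<^esub> null_space (H_tilde \<U> G N)))"

definition pi_gamma ::
  "nat filter \<Rightarrow> ('g, 'b) monoid_scheme \<Rightarrow> (nat \<Rightarrow> 'g set) \<Rightarrow> (nat \<Rightarrow> nat)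
     \<Rightarrow> ('g, (nat \<Rightarrow> (nat \<Rightarrow> 'g set \<Rightarrow> complex) set) set) rep" where
  "pi_gamma \<U> G N \<gamma> =
     \<lparr>rep_space = (H_hat \<U> G N)\<lparr>carrier := H_gamma \<U> G N \<gamma>\<rparr>,
      rep_act = lambda_hat \<U> G N\<rparr>"

end

theory Submission
  imports Defs
begin

text \<open>
  Fix an element \<open>a\<close> of the group algebra and let \<open>c\<^sub>n\<close> be the operator norm of \<open>\<lambda>\<^sub>n(a)\<close>.  Both
  representations turn out to have norm \<open>sup c\<^sub>n\<close> at \<open>a\<close>, for the same two reasons.

  Upper bound: a constant \<open>C\<close> with \<open>\<parallel>\<lambda>\<^sub>n(a)x\<parallel> \<le> C \<parallel>x\<parallel>\<close> for all \<open>n\<close> and \<open>x\<close> survives every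
  construction involved.  Spaces of sequences whose form is a positive functional
  (a sum, a limit, a limit along \<open>\<U>\<close>) applied to the termwise forms inherit it, because the
  functional is monotone (\<open>bounded_by_seq_rep\<close>); a quotient by the null vectors inherits it because the
  quotient map preserves norms (\<open>bounded_by_separation\<close>).  Since every subset of \<open>X\<^sub>n\<close> has at most \<open>\<nu>\<^sub>n\<close>
  elements, the support condition for the maximal growth function is vacuous, so \<open>\<pi>\<^sub>\<nu>\<close> acts on the
  whole ultraproduct and is composed of exactly these constructions (\<open>pi_gamma_nu\<close>).

  Lower bound: each \<open>\<lambda>\<^sub>m\<close> embeds isometrically and equivariantly into both representations.  For the
  direct sum this is the inclusion of a summand.  For \<open>\<pi>\<^sub>\<nu>\<close>, functions on \<open>X\<^sub>m\<close> are pulled back to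
  \<open>X\<^sub>n\<close> for \<open>n \<ge> m\<close> and rescaled by the square root of the fibre size (\<open>coset_pullback\<close>); the resulting
  sequence, extended by \<open>0\<close> for \<open>n < m\<close>, has the right norm because a non-principal
  ultrafilter does not see the indices below \<open>m\<close>.

  The formal mechanism behind both bounds is that the extension of a representation to the group
  algebra commutes with every intertwiner (\<open>rep_ext_intertwine\<close>).  Evaluation of sequences, quotient maps, constant
  sequences and the embeddings above are all intertwiners, so that the finite sums
  defining \<open>\<pi>(a)\<close> never have to be computed in the quotients and completions themselves.
\<close>

section \<open>Semi-inner product spaces\<close>

text \<open>
  Definiteness is absent on purpose: bounded sequences and Cauchy sequences carry only
  semidefinite forms, and it is their quotients by null vectors that become definite.
\<close>

locale semi_ip = abelian_group V for V :: "'v ip_space" (structure) +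
  assumes smult_closed [simp, intro]: "x \<in> carrier V \<Longrightarrow> c \<odot> x \<in> carrier V"
    and smult_l_distr: "x \<in> carrier V \<Longrightarrow> (c + d) \<odot> x = c \<odot> x \<oplus> d \<odot> x"
    and smult_r_distr: "x \<in> carrier V \<Longrightarrow> y \<in> carrier V \<Longrightarrow> c \<odot> (x \<oplus> y) = c \<odot> x \<oplus> c \<odot> y"
    and smult_assoc: "x \<in> carrier V \<Longrightarrow> (c * d) \<odot> x = c \<odot> (d \<odot> x)"
    and smult_one: "x \<in> carrier V \<Longrightarrow> 1 \<odot> x = x"
    and iprod_add: "x \<in> carrier V \<Longrightarrow> y \<in> carrier V \<Longrightarrow> z \<in> carrier V \<Longrightarrow>
      iprod V (x \<oplus> y) z = iprod V x z + iprod V y z"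
    and iprod_smult: "x \<in> carrier V \<Longrightarrow> y \<in> carrier V \<Longrightarrow> iprod V (c \<odot> x) y = c * iprod V x y"
    and iprod_cnj: "x \<in> carrier V \<Longrightarrow> y \<in> carrier V \<Longrightarrow> iprod V y x = cnj (iprod V x y)"
    and iprod_nonneg: "x \<in> carrier V \<Longrightarrow> 0 \<le> Re (iprod V x x)"
begin

lemma smult_0_left: assumes x: "x \<in> carrier V" shows "0 \<odot> x = \<zero>"
proof -
  have "0 \<odot> x \<oplus> 0 \<odot> x = 0 \<odot> x \<oplus> \<zero>"
    using smult_l_distr[OF x, of 0 0] x by simp
  then show ?thesis using r_neg1[of "0 \<odot> x" "0 \<odot> x"] r_neg1[of "0 \<odot> x" \<zero>] x by simp
qed

lemma smult_0_right: "c \<odot> \<zero> = \<zero>"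
  by (metis mult_zero_right smult_0_left smult_assoc zero_closed)

lemma minus_conv_smult:
  assumes "x \<in> carrier V" "y \<in> carrier V"
  shows "x \<ominus> y = x \<oplus> (- 1) \<odot> y"
proof -
  have "y \<oplus> (- 1) \<odot> y = \<zero>"
    using smult_l_distr[of y 1 "-1"] smult_one[of y] smult_0_left[of y] assms by simp
  then have "\<ominus> y = (- 1) \<odot> y"
    using assms by (metis a_comm minus_equality smult_closed)
  then show ?thesis by (simp add: a_minus_def)
qed

lemma minus_self: "x \<in> carrier V \<Longrightarrow> x \<ominus> x = \<zero>"
  by (simp add: a_minus_def r_neg)

lemma add_minus_cancel: "x \<in> carrier V \<Longrightarrow> y \<in> carrier V \<Longrightarrow> y \<oplus> (x \<ominus> y) = x"
  by (metis a_comm a_inv_closed a_minus_def minus_closed r_neg2)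

lemma iprod_add_right:
  assumes "x \<in> carrier V" "y \<in> carrier V" "z \<in> carrier V"
  shows "iprod V z (x \<oplus> y) = iprod V z x + iprod V z y"
  using assms iprod_cnj[of "x \<oplus> y" z] iprod_cnj[of x z] iprod_cnj[of y z]
  by (simp add: iprod_add)

lemma iprod_smult_right:
  assumes "x \<in> carrier V" "y \<in> carrier V"
  shows "iprod V x (c \<odot> y) = cnj c * iprod V x y"
  using assms iprod_cnj[of "c \<odot> y" x] iprod_cnj[of y x]
  by (simp add: iprod_smult)

lemma iprod_self:
  assumes "x \<in> carrier V" shows "iprod V x x = of_real ((vnorm V x)\<^sup>2)"
proof -
  have "Im (iprod V x x) = 0" using iprod_cnj[OF assms assms] by (metis Im_complex_of_real Reals_cnj_iff complex_is_Real_iff)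
  then show ?thesis using iprod_nonneg[OF assms] by (simp add: vnorm_def complex_eq_iff)
qed

lemma vnorm_nonneg: "x \<in> carrier V \<Longrightarrow> 0 \<le> vnorm V x"
  by (simp add: vnorm_def iprod_nonneg)

lemma vnorm_smult: "x \<in> carrier V \<Longrightarrow> vnorm V (c \<odot> x) = cmod c * vnorm V x"
proof -
  assume x: "x \<in> carrier V"
  have "iprod V (c \<odot> x) (c \<odot> x) = (c * cnj c) * iprod V x x"
    using x by (simp add: iprod_smult iprod_smult_right)
  also have "\<dots> = of_real ((cmod c * vnorm V x)\<^sup>2)"
    using x by (simp add: iprod_self power_mult_distrib complex_mult_cnj cmod_power2)
  finally show ?thesis
    using vnorm_nonneg[OF x] by (simp add: vnorm_def[of V "c \<odot> x"] real_sqrt_abs del: of_real_power of_real_mult)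
qed

lemma vnorm_zero [simp]: "vnorm V \<zero> = 0"
  using vnorm_smult[of \<zero> 0] by (simp add: smult_0_right)

lemma vnorm_add_smult_sq:
  assumes "x \<in> carrier V" "y \<in> carrier V"
  shows "(vnorm V (x \<oplus> c \<odot> y))\<^sup>2
    = (vnorm V x)\<^sup>2 + 2 * Re (cnj c * iprod V x y) + (cmod c)\<^sup>2 * (vnorm V y)\<^sup>2"
proof -
  have "iprod V (x \<oplus> c \<odot> y) (x \<oplus> c \<odot> y)
     = iprod V x x + cnj c * iprod V x y + c * iprod V y x + (c * cnj c) * iprod V y y"
    using assms by (simp add: iprod_add iprod_add_right iprod_smult iprod_smult_right algebra_simps)
  also have "c * iprod V y x = cnj (cnj c * iprod V x y)"
    using assms iprod_cnj[of x y] by simp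
  finally have "Re (iprod V (x \<oplus> c \<odot> y) (x \<oplus> c \<odot> y)) = Re (iprod V x x)
      + 2 * Re (cnj c * iprod V x y) + Re ((c * cnj c) * iprod V y y)"
    by (simp del: complex_cnj_mult)
  moreover have "Re ((c * cnj c) * iprod V y y) = (cmod c)\<^sup>2 * (vnorm V y)\<^sup>2"
    using assms by (simp add: iprod_self complex_mult_cnj cmod_power2)
  moreover have "Re (iprod V z z) = (vnorm V z)\<^sup>2" if "z \<in> carrier V" for z
    using that by (simp add: iprod_self)
  ultimately show ?thesis using assms by simp
qed

text \<open>
  Expresses the form by squared norms alone; convergence of all the termwise forms of
  two sequences then follows from convergence of their squared norms.
\<close>

lemma polarization:
  assumes "x \<in> carrier V" "y \<in> carrier V"
  shows "iprod V x y =
    (of_real ((vnorm V (x \<oplus> 1 \<odot> y))\<^sup>2) - of_real ((vnorm V (x \<oplus> (-1) \<odot> y))\<^sup>2)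
     + \<i> * of_real ((vnorm V (x \<oplus> \<i> \<odot> y))\<^sup>2) - \<i> * of_real ((vnorm V (x \<oplus> (-\<i>) \<odot> y))\<^sup>2)) / 4"
  using assms by (simp add: vnorm_add_smult_sq complex_eq_iff del: of_real_power)

lemma Cauchy_Schwarz:
  assumes x: "x \<in> carrier V" and y: "y \<in> carrier V"
  shows "cmod (iprod V x y) \<le> vnorm V x * vnorm V y"
proof -
  let ?p = "iprod V x y" and ?m = "(cmod (iprod V x y))\<^sup>2"
  \<comment> \<open>The square of the norm of \<open>x - t \<langle>x,y\<rangle> y\<close>; a real parameter \<open>t\<close> also serves the case \<open>\<parallel>y\<parallel> = 0\<close>.\<close>
  have *: "0 \<le> (vnorm V x)\<^sup>2 - 2 * t * ?m + t\<^sup>2 * ?m * (vnorm V y)\<^sup>2" for t :: real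
  proof -
    have "Re (cnj (- of_real t * ?p) * ?p) = - t * ?m"
      unfolding cmod_power2 by (simp add: power2_eq_square algebra_simps)
    then show ?thesis
      using vnorm_add_smult_sq[OF x y, of "- of_real t * ?p"] zero_le_power2[of "vnorm V (x \<oplus> (- of_real t * ?p) \<odot> y)"]
      by (simp add: norm_mult power_mult_distrib)
  qed
  have "?m \<le> (vnorm V x)\<^sup>2 * (vnorm V y)\<^sup>2"
  proof (cases "vnorm V y = 0")
    case True
    show ?thesis
    proof (rule ccontr)
      assume "\<not> ?thesis"
      then have m: "?m > 0" using True by simp
      define t where "t = ((vnorm V x)\<^sup>2 + 1) / ?m"
      have "t * ?m = (vnorm V x)\<^sup>2 + 1" using m by (simp add: t_def)
      then show False using *[of t] True zero_le_power2[of "vnorm V x"] by simp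
    qed
  next
    case False
    define t where "t = 1 / (vnorm V y)\<^sup>2"
    have t: "t * (vnorm V y)\<^sup>2 = 1" "t > 0" using False by (simp_all add: t_def)
    have "t\<^sup>2 * ?m * (vnorm V y)\<^sup>2 = t * ?m * (t * (vnorm V y)\<^sup>2)"
      by (simp add: power2_eq_square)
    then have "t\<^sup>2 * ?m * (vnorm V y)\<^sup>2 = t * ?m" unfolding t(1) by simp
    then have "t * ?m \<le> (vnorm V x)\<^sup>2" using *[of t] by linarith
    then have "t * ?m * (vnorm V y)\<^sup>2 \<le> (vnorm V x)\<^sup>2 * (vnorm V y)\<^sup>2"
      by (simp add: mult_right_mono)
    moreover have "t * ?m * (vnorm V y)\<^sup>2 = ?m * (t * (vnorm V y)\<^sup>2)" by simp
    ultimately show ?thesis unfolding t(1) by simp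
  qed
  then have "?m \<le> (vnorm V x * vnorm V y)\<^sup>2" by (simp add: power_mult_distrib)
  then show ?thesis using vnorm_nonneg x y by (meson mult_nonneg_nonneg power2_le_imp_le)
qed

lemma vnorm_triangle:
  assumes x: "x \<in> carrier V" and y: "y \<in> carrier V"
  shows "vnorm V (x \<oplus> y) \<le> vnorm V x + vnorm V y"
proof -
  have "(vnorm V (x \<oplus> y))\<^sup>2 = (vnorm V x)\<^sup>2 + 2 * Re (iprod V x y) + (vnorm V y)\<^sup>2"
    using vnorm_add_smult_sq[OF x y, of 1] y by (simp add: smult_one)
  also have "\<dots> \<le> (vnorm V x + vnorm V y)\<^sup>2"
    using Cauchy_Schwarz[OF x y] complex_Re_le_cmod[of "iprod V x y"]
    by (simp add: power2_sum)
  finally show ?thesis using vnorm_nonneg x y by (meson add_nonneg_nonneg power2_le_imp_le)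
qed

lemma vnorm_minus_commute:
  assumes x: "x \<in> carrier V" and y: "y \<in> carrier V"
  shows "vnorm V (x \<ominus> y) = vnorm V (y \<ominus> x)"
proof -
  have "x \<ominus> y = (-1) \<odot> (y \<ominus> x)"
    using x y by (simp add: minus_conv_smult smult_r_distr smult_assoc[symmetric] smult_one a_comm)
  then show ?thesis using x y by (simp add: vnorm_smult)
qed

lemma vnorm_diff_le:
  assumes x: "x \<in> carrier V" and y: "y \<in> carrier V"
  shows "\<bar>vnorm V x - vnorm V y\<bar> \<le> vnorm V (x \<ominus> y)"
  using vnorm_triangle[of y "x \<ominus> y"] vnorm_triangle[of x "y \<ominus> x"] assms
    vnorm_minus_commute[OF x y] by (simp add: add_minus_cancel)

lemma null_space_iff: "x \<in> null_space V \<longleftrightarrow> x \<in> carrier V \<and> vnorm V x = 0"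
  by (auto simp: null_space_def iprod_self)

lemma abelian_subgroup_null_space: "abelian_subgroup (null_space V) V"
proof (rule abelian_subgroupI3)
  show "additive_subgroup (null_space V) V"
  proof (rule additive_subgroup.intro, rule group.subgroupI, goal_cases)
    case 1 show ?case by (rule a_group)
  next
    case (4 a)
    then have "\<ominus> a = (-1) \<odot> a" using minus_conv_smult[of \<zero> a] by (simp add: null_space_iff a_minus_def)
    with 4 show ?case by (simp add: null_space_iff a_inv_def[symmetric] vnorm_smult)
  next
    case (5 a b)
    then show ?case using vnorm_triangle[of a b] vnorm_nonneg[of "a \<oplus> b"] by (auto simp: null_space_iff)
  next
    case 2 show ?case by (auto simp: null_space_def)
  next
    case 3
    have "\<zero> \<in> null_space V" by (simp add: null_space_iff)
    then show ?case by blast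
  qed
  show "abelian_group V" ..
qed

lemma null_class_iff:
  assumes x: "x \<in> carrier V"
  shows "y \<in> null_class V x \<longleftrightarrow> y \<in> carrier V \<and> vnorm V (y \<ominus> x) = 0"
proof
  assume "y \<in> null_class V x"
  then obtain h where h: "h \<in> carrier V" "vnorm V h = 0" "y = h \<oplus> x"
    by (auto simp: null_class_def a_r_coset_def' null_space_iff)
  then have "y \<ominus> x = h" using x by (simp add: a_minus_def a_assoc r_neg)
  then show "y \<in> carrier V \<and> vnorm V (y \<ominus> x) = 0" using h x by simp
next
  assume "y \<in> carrier V \<and> vnorm V (y \<ominus> x) = 0"
  moreover from this have "y = (y \<ominus> x) \<oplus> x" using x by (metis a_comm add_minus_cancel minus_closed)
  ultimately show "y \<in> null_class V x" using x
    unfolding null_class_def a_r_coset_def' by (auto simp: null_space_iff)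
qed

lemma null_class_self: "x \<in> carrier V \<Longrightarrow> x \<in> null_class V x"
  by (simp add: null_class_iff minus_self)

lemma null_class_eqI:
  assumes "x \<in> carrier V" "y \<in> carrier V" "vnorm V (y \<ominus> x) = 0"
  shows "null_class V y = null_class V x"
proof -
  interpret N: abelian_subgroup "null_space V" V by (rule abelian_subgroup_null_space)
  have "y \<in> null_space V +> x" using assms null_class_iff[of x y] by (simp add: null_class_def)
  then show ?thesis unfolding null_class_def
    using a_repr_independence[OF _ assms(1) N.a_subgroup] by simp
qed

end

section \<open>Linear maps and intertwiners\<close>

definition linear_map :: "'v ip_space \<Rightarrow> 'w ip_space \<Rightarrow> ('v \<Rightarrow> 'w) \<Rightarrow> bool" where
  "linear_map V W J \<longleftrightarrow> (\<forall>x\<in>carrier V. J x \<in> carrier W) \<and>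
     (\<forall>x\<in>carrier V. \<forall>y\<in>carrier V. J (x \<oplus>\<^bsub>V\<^esub> y) = J x \<oplus>\<^bsub>W\<^esub> J y) \<and>
     (\<forall>c. \<forall>x\<in>carrier V. J (c \<odot>\<^bsub>V\<^esub> x) = c \<odot>\<^bsub>W\<^esub> J x)"

definition norm_preserving :: "'v ip_space \<Rightarrow> 'w ip_space \<Rightarrow> ('v \<Rightarrow> 'w) \<Rightarrow> bool" where
  "norm_preserving V W J \<longleftrightarrow> (\<forall>x\<in>carrier V. vnorm W (J x) = vnorm V x)"

definition bounded_by :: "'v ip_space \<Rightarrow> real \<Rightarrow> ('v \<Rightarrow> 'v) \<Rightarrow> bool" where
  "bounded_by V C T \<longleftrightarrow> (\<forall>x\<in>carrier V. vnorm V (T x) \<le> C * vnorm V x)"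

text \<open>
  Unitary representations are of this kind.  Contractivity is an inequality between norms and
  hence passes termwise to spaces of sequences.
\<close>

definition contractive_rep :: "('g, 'b) monoid_scheme \<Rightarrow> ('g, 'v) rep \<Rightarrow> bool" where
  "contractive_rep G \<pi> \<longleftrightarrow> semi_ip (rep_space \<pi>) \<and>
     (\<forall>g\<in>carrier G. linear_map (rep_space \<pi>) (rep_space \<pi>) (rep_act \<pi> g) \<and>
                    bounded_by (rep_space \<pi>) 1 (rep_act \<pi> g))"

text \<open>
  Norms are left out here: evaluation of a sequence at an index is an intertwiner that is not
  norm-preserving.
\<close>

definition intertwiner ::
  "('g, 'b) monoid_scheme \<Rightarrow> ('g, 'v) rep \<Rightarrow> ('g, 'w) rep \<Rightarrow> ('v \<Rightarrow> 'w) \<Rightarrow> bool" where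
  "intertwiner G \<pi> \<rho> J \<longleftrightarrow> linear_map (rep_space \<pi>) (rep_space \<rho>) J \<and>
     (\<forall>g\<in>carrier G. \<forall>x\<in>carrier (rep_space \<pi>). J (rep_act \<pi> g x) = rep_act \<rho> g (J x))"

lemma linear_mapD:
  assumes "linear_map V W J"
  shows "x \<in> carrier V \<Longrightarrow> J x \<in> carrier W"
    and "x \<in> carrier V \<Longrightarrow> y \<in> carrier V \<Longrightarrow> J (x \<oplus>\<^bsub>V\<^esub> y) = J x \<oplus>\<^bsub>W\<^esub> J y"
    and "x \<in> carrier V \<Longrightarrow> J (c \<odot>\<^bsub>V\<^esub> x) = c \<odot>\<^bsub>W\<^esub> J x"
  using assms by (auto simp: linear_map_def)

lemma linear_map_zero:
  assumes "semi_ip V" "semi_ip W" "linear_map V W J"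
  shows "J \<zero>\<^bsub>V\<^esub> = \<zero>\<^bsub>W\<^esub>"
proof -
  interpret V: semi_ip V by fact
  interpret W: semi_ip W by fact
  have "J (0 \<odot>\<^bsub>V\<^esub> \<zero>\<^bsub>V\<^esub>) = 0 \<odot>\<^bsub>W\<^esub> J \<zero>\<^bsub>V\<^esub>" using linear_mapD(3)[OF assms(3)] by simp
  then show ?thesis
    using V.smult_0_right W.smult_0_left linear_mapD(1)[OF assms(3) V.zero_closed] by simp
qed

lemma linear_map_minus:
  assumes "semi_ip V" "semi_ip W" "linear_map V W J" "x \<in> carrier V" "y \<in> carrier V"
  shows "J (x \<ominus>\<^bsub>V\<^esub> y) = J x \<ominus>\<^bsub>W\<^esub> J y"
proof -
  interpret V: semi_ip V by fact
  interpret W: semi_ip W by fact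
  show ?thesis
    using assms(4,5) linear_mapD[OF assms(3)] by (simp add: V.minus_conv_smult W.minus_conv_smult)
qed

lemma linear_map_finsum:
  assumes "semi_ip V" "semi_ip W" "linear_map V W J" "finite A" "\<And>g. g \<in> A \<Longrightarrow> f g \<in> carrier V"
  shows "J (finsum V f A) = finsum W (\<lambda>g. J (f g)) A"
  using assms(4,5)
proof (induction A)
  interpret V: semi_ip V by fact
  interpret W: semi_ip W by fact
  case empty
  show ?case using linear_map_zero[OF assms(1-3)] by simp
next
  interpret V: semi_ip V by fact
  interpret W: semi_ip W by fact
  case (insert g A)
  have "f \<in> A \<rightarrow> carrier V" "f g \<in> carrier V"
    "(\<lambda>g. J (f g)) \<in> A \<rightarrow> carrier W" "J (f g) \<in> carrier W"
    using insert.prems linear_mapD(1)[OF assms(3)] by auto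
  with insert show ?case using linear_mapD(2)[OF assms(3)] by (simp add: V.finsum_insert W.finsum_insert)
qed

lemma finsum_vnorm_le:
  assumes "semi_ip V" "finite A" "\<And>g. g \<in> A \<Longrightarrow> f g \<in> carrier V"
    "\<And>g. g \<in> A \<Longrightarrow> vnorm V (f g) \<le> b g"
  shows "vnorm V (finsum V f A) \<le> (\<Sum>g\<in>A. b g)"
  using assms(2-4)
proof (induction A)
  interpret V: semi_ip V by fact
  case empty
  show ?case by simp
next
  interpret V: semi_ip V by fact
  case (insert g A)
  have f: "f \<in> A \<rightarrow> carrier V" "f g \<in> carrier V" using insert.prems by auto
  have "vnorm V (finsum V f (insert g A)) \<le> vnorm V (f g) + vnorm V (finsum V f A)"
    using f insert.hyps V.vnorm_triangle V.finsum_closed by (simp add: V.finsum_insert)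
  also have "\<dots> \<le> b g + (\<Sum>g\<in>A. b g)"
    by (intro add_mono insert.IH) (use insert.prems in auto)
  finally show ?case using insert.hyps by simp
qed

context
  fixes G :: "('g, 'b) monoid_scheme" and a :: "'g \<Rightarrow> complex"
  assumes a: "a \<in> group_algebra G"
begin

lemma group_algebra_supp: "finite {g. a g \<noteq> 0}" "\<And>g. a g \<noteq> 0 \<Longrightarrow> g \<in> carrier G"
  using a by (auto simp: group_algebra_def)

lemma summand_closed:
  assumes "contractive_rep G \<pi>" "x \<in> carrier (rep_space \<pi>)" "a g \<noteq> 0"
  shows "rep_act \<pi> g x \<in> carrier (rep_space \<pi>)"
    and "a g \<odot>\<^bsub>rep_space \<pi>\<^esub> rep_act \<pi> g x \<in> carrier (rep_space \<pi>)"
proof -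
  interpret V: semi_ip "rep_space \<pi>" using assms by (simp add: contractive_rep_def)
  show "rep_act \<pi> g x \<in> carrier (rep_space \<pi>)"
    using assms group_algebra_supp(2) by (auto simp: contractive_rep_def linear_map_def)
  then show "a g \<odot>\<^bsub>rep_space \<pi>\<^esub> rep_act \<pi> g x \<in> carrier (rep_space \<pi>)" by simp
qed

lemma rep_ext_closed:
  assumes "contractive_rep G \<pi>" "x \<in> carrier (rep_space \<pi>)"
  shows "rep_ext \<pi> a x \<in> carrier (rep_space \<pi>)"
proof -
  interpret V: semi_ip "rep_space \<pi>" using assms by (simp add: contractive_rep_def)
  show ?thesis unfolding rep_ext_def
    using summand_closed[OF assms] by (intro V.finsum_closed) auto
qed

text \<open>
  An intertwiner is additive, so it passes through the finite sum defining \<open>\<pi>(a)\<close>.  With this,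
  \<open>\<pi>(a)\<close> is known on every quotient and on every space of sequences as soon as it is known on
  the building blocks.
\<close>

lemma rep_ext_intertwine:
  assumes \<pi>: "contractive_rep G \<pi>" and \<rho>: "contractive_rep G \<rho>" and J: "intertwiner G \<pi> \<rho> J"
    and x: "x \<in> carrier (rep_space \<pi>)"
  shows "J (rep_ext \<pi> a x) = rep_ext \<rho> a (J x)"
proof -
  interpret V: semi_ip "rep_space \<pi>" using \<pi> by (simp add: contractive_rep_def)
  interpret W: semi_ip "rep_space \<rho>" using \<rho> by (simp add: contractive_rep_def)
  have lin: "linear_map (rep_space \<pi>) (rep_space \<rho>) J" using J by (simp add: intertwiner_def)
  have Jx: "J x \<in> carrier (rep_space \<rho>)" using linear_mapD(1)[OF lin x] .
  have eq: "J (a g \<odot>\<^bsub>rep_space \<pi>\<^esub> rep_act \<pi> g x) = a g \<odot>\<^bsub>rep_space \<rho>\<^esub> rep_act \<rho> g (J x)"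
    if "a g \<noteq> 0" for g
    using summand_closed[OF \<pi> x that] linear_mapD(3)[OF lin] J group_algebra_supp(2)[OF that] x
    by (simp add: intertwiner_def)
  have "J (rep_ext \<pi> a x)
      = finsum (rep_space \<rho>) (\<lambda>g. J (a g \<odot>\<^bsub>rep_space \<pi>\<^esub> rep_act \<pi> g x)) {g. a g \<noteq> 0}"
    unfolding rep_ext_def
    by (rule linear_map_finsum[OF V.semi_ip_axioms W.semi_ip_axioms lin group_algebra_supp(1)])
       (use summand_closed[OF \<pi> x] in auto)
  also have "\<dots> = rep_ext \<rho> a (J x)"
    unfolding rep_ext_def
    by (rule W.finsum_cong') (use eq summand_closed[OF \<rho> Jx] in auto)
  finally show ?thesis .
qed

text \<open>
  Scalar multiplication is an intertwiner of a representation with itself.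
\<close>

lemma rep_ext_smult:
  assumes \<pi>: "contractive_rep G \<pi>" and x: "x \<in> carrier (rep_space \<pi>)"
  shows "rep_ext \<pi> a (c \<odot>\<^bsub>rep_space \<pi>\<^esub> x) = c \<odot>\<^bsub>rep_space \<pi>\<^esub> rep_ext \<pi> a x"
proof -
  interpret V: semi_ip "rep_space \<pi>" using \<pi> by (simp add: contractive_rep_def)
  have "intertwiner G \<pi> \<pi> (\<lambda>x. c \<odot>\<^bsub>rep_space \<pi>\<^esub> x)"
    using \<pi> by (auto simp: intertwiner_def linear_map_def contractive_rep_def V.smult_r_distr
        V.smult_assoc[symmetric] mult.commute)
  from rep_ext_intertwine[OF \<pi> \<pi> this x] show ?thesis by simp
qed

text \<open>
  The \<open>l\<^sup>1\<close> norm of \<open>a\<close> bounds every \<open>\<pi>(a)\<close>.  This makes the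
  supremum in the operator norm that of a bounded set and shows that null vectors are mapped to null vectors.
\<close>

lemma rep_ext_crude_bound:
  assumes \<pi>: "contractive_rep G \<pi>"
  shows "bounded_by (rep_space \<pi>) (\<Sum>g | a g \<noteq> 0. cmod (a g)) (rep_ext \<pi> a)"
  unfolding bounded_by_def
proof
  interpret V: semi_ip "rep_space \<pi>" using \<pi> by (simp add: contractive_rep_def)
  fix x assume x: "x \<in> carrier (rep_space \<pi>)"
  have "vnorm (rep_space \<pi>) (rep_ext \<pi> a x) \<le> (\<Sum>g | a g \<noteq> 0. cmod (a g) * vnorm (rep_space \<pi>) x)"
    unfolding rep_ext_def
  proof (rule finsum_vnorm_le[OF V.semi_ip_axioms group_algebra_supp(1)])
    fix g assume "g \<in> {g. a g \<noteq> 0}"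
    then have g: "a g \<noteq> 0" by simp
    then have "vnorm (rep_space \<pi>) (rep_act \<pi> g x) \<le> vnorm (rep_space \<pi>) x"
      using \<pi> x group_algebra_supp(2) by (auto simp: contractive_rep_def bounded_by_def)
    then show "vnorm (rep_space \<pi>) (a g \<odot>\<^bsub>rep_space \<pi>\<^esub> rep_act \<pi> g x) \<le> cmod (a g) * vnorm (rep_space \<pi>) x"
      using summand_closed[OF \<pi> x g] by (simp add: V.vnorm_smult mult_left_mono)
  qed (use summand_closed[OF \<pi> x] in auto)
  then show "vnorm (rep_space \<pi>) (rep_ext \<pi> a x) \<le> (\<Sum>g | a g \<noteq> 0. cmod (a g)) * vnorm (rep_space \<pi>) x"
    by (simp add: sum_distrib_right)
qed

lemma opnorm_le:
  assumes "contractive_rep G \<pi>" "0 \<le> C" "bounded_by (rep_space \<pi>) C (rep_ext \<pi> a)"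
  shows "opnorm (rep_space \<pi>) (rep_ext \<pi> a) \<le> C"
  unfolding opnorm_def
proof (rule cSUP_least)
  interpret V: semi_ip "rep_space \<pi>" using assms by (simp add: contractive_rep_def)
  have "\<zero>\<^bsub>rep_space \<pi>\<^esub> \<in> {x \<in> carrier (rep_space \<pi>). vnorm (rep_space \<pi>) x \<le> 1}" by simp
  then show "{x \<in> carrier (rep_space \<pi>). vnorm (rep_space \<pi>) x \<le> 1} \<noteq> {}" by blast
  fix x assume "x \<in> {x \<in> carrier (rep_space \<pi>). vnorm (rep_space \<pi>) x \<le> 1}"
  then have x: "x \<in> carrier (rep_space \<pi>)" "vnorm (rep_space \<pi>) x \<le> 1" by auto
  have "vnorm (rep_space \<pi>) (rep_ext \<pi> a x) \<le> C * vnorm (rep_space \<pi>) x"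
    using assms x by (simp add: bounded_by_def)
  also have "\<dots> \<le> C" using x(2) assms(2) by (simp add: mult_left_le)
  finally show "vnorm (rep_space \<pi>) (rep_ext \<pi> a x) \<le> C" .
qed

lemma opnorm_upper:
  assumes \<pi>: "contractive_rep G \<pi>" and x: "x \<in> carrier (rep_space \<pi>)" "vnorm (rep_space \<pi>) x \<le> 1"
  shows "vnorm (rep_space \<pi>) (rep_ext \<pi> a x) \<le> opnorm (rep_space \<pi>) (rep_ext \<pi> a)"
  unfolding opnorm_def
proof (rule cSUP_upper)
  show "x \<in> {x \<in> carrier (rep_space \<pi>). vnorm (rep_space \<pi>) x \<le> 1}" using x by simp
  let ?C = "\<Sum>g | a g \<noteq> 0. cmod (a g)"
  show "bdd_above ((\<lambda>x. vnorm (rep_space \<pi>) (rep_ext \<pi> a x)) ` {x \<in> carrier (rep_space \<pi>). vnorm (rep_space \<pi>) x \<le> 1})"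
  proof (rule bdd_aboveI2)
    fix x assume "x \<in> {x \<in> carrier (rep_space \<pi>). vnorm (rep_space \<pi>) x \<le> 1}"
    then have x: "x \<in> carrier (rep_space \<pi>)" "vnorm (rep_space \<pi>) x \<le> 1" by auto
    have "vnorm (rep_space \<pi>) (rep_ext \<pi> a x) \<le> ?C * vnorm (rep_space \<pi>) x"
      using rep_ext_crude_bound[OF \<pi>] x by (simp add: bounded_by_def)
    also have "\<dots> \<le> ?C" using x(2) by (simp add: mult_left_le sum_nonneg)
    finally show "vnorm (rep_space \<pi>) (rep_ext \<pi> a x) \<le> ?C" .
  qed
qed

lemma opnorm_nonneg:
  assumes \<pi>: "contractive_rep G \<pi>"
  shows "0 \<le> opnorm (rep_space \<pi>) (rep_ext \<pi> a)"
proof -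
  interpret V: semi_ip "rep_space \<pi>" using \<pi> by (simp add: contractive_rep_def)
  have "0 \<le> vnorm (rep_space \<pi>) (rep_ext \<pi> a \<zero>\<^bsub>rep_space \<pi>\<^esub>)"
    using V.vnorm_nonneg rep_ext_closed[OF \<pi>] by simp
  also have "\<dots> \<le> opnorm (rep_space \<pi>) (rep_ext \<pi> a)" by (rule opnorm_upper[OF \<pi>]) auto
  finally show ?thesis .
qed

text \<open>
  Vectors of positive norm are rescaled to unit norm; on null vectors, which cannot be
  rescaled, the crude bound gives that the image is null as well.
\<close>

lemma bounded_by_opnorm:
  assumes \<pi>: "contractive_rep G \<pi>"
  shows "bounded_by (rep_space \<pi>) (opnorm (rep_space \<pi>) (rep_ext \<pi> a)) (rep_ext \<pi> a)"
  unfolding bounded_by_def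
proof
  interpret V: semi_ip "rep_space \<pi>" using \<pi> by (simp add: contractive_rep_def)
  fix x assume x: "x \<in> carrier (rep_space \<pi>)"
  let ?r = "vnorm (rep_space \<pi>) x" and ?D = "opnorm (rep_space \<pi>) (rep_ext \<pi> a)"
  show "vnorm (rep_space \<pi>) (rep_ext \<pi> a x) \<le> ?D * ?r"
  proof (cases "?r = 0")
    case True
    then show ?thesis using rep_ext_crude_bound[OF \<pi>] x by (force simp: bounded_by_def)
  next
    case False
    then have r: "?r > 0" using V.vnorm_nonneg[OF x] by simp
    have "vnorm (rep_space \<pi>) (rep_ext \<pi> a (of_real (1 / ?r) \<odot>\<^bsub>rep_space \<pi>\<^esub> x)) \<le> ?D"
      using r x by (intro opnorm_upper[OF \<pi>]) (auto simp: V.vnorm_smult norm_divide)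
    then have "(1 / ?r) * vnorm (rep_space \<pi>) (rep_ext \<pi> a x) \<le> ?D"
      using r x by (simp add: rep_ext_smult[OF \<pi>] V.vnorm_smult rep_ext_closed[OF \<pi>] norm_divide)
    then show ?thesis using r by (simp add: field_simps)
  qed
qed

text \<open>
  A subrepresentation has no larger norms; the lower bounds in the main theorem are of this
  kind.
\<close>

lemma bounded_by_transfer:
  assumes \<pi>: "contractive_rep G \<pi>" and \<rho>: "contractive_rep G \<rho>" and J: "intertwiner G \<pi> \<rho> J"
    and iso: "norm_preserving (rep_space \<pi>) (rep_space \<rho>) J"
    and bd: "bounded_by (rep_space \<rho>) C (rep_ext \<rho> a)"
  shows "bounded_by (rep_space \<pi>) C (rep_ext \<pi> a)"
  unfolding bounded_by_def
proof
  fix x assume x: "x \<in> carrier (rep_space \<pi>)"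
  have Jx: "J x \<in> carrier (rep_space \<rho>)" using J x by (simp add: intertwiner_def linear_map_def)
  have "vnorm (rep_space \<pi>) (rep_ext \<pi> a x) = vnorm (rep_space \<rho>) (rep_ext \<rho> a (J x))"
    using iso rep_ext_closed[OF \<pi> x] rep_ext_intertwine[OF \<pi> \<rho> J x] by (metis norm_preserving_def)
  also have "\<dots> \<le> C * vnorm (rep_space \<pi>) x"
    using bd iso Jx x unfolding bounded_by_def norm_preserving_def by metis
  finally show "vnorm (rep_space \<pi>) (rep_ext \<pi> a x) \<le> C * vnorm (rep_space \<pi>) x" .
qed

end

lemma intertwiner_comp:
  assumes "intertwiner G \<pi> \<rho> J" "intertwiner G \<rho> \<sigma> K"
  shows "intertwiner G \<pi> \<sigma> (\<lambda>x. K (J x))"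
  using assms by (auto simp: intertwiner_def linear_map_def)

lemma norm_preserving_comp:
  assumes "intertwiner G \<pi> \<rho> J" "norm_preserving (rep_space \<pi>) (rep_space \<rho>) J"
    "norm_preserving (rep_space \<rho>) (rep_space \<sigma>) K"
  shows "norm_preserving (rep_space \<pi>) (rep_space \<sigma>) (\<lambda>x. K (J x))"
  using assms by (auto simp: norm_preserving_def intertwiner_def linear_map_def)

section \<open>Separation\<close>

definition separation_rep :: "('g, 'v) rep \<Rightarrow> ('g, 'v set) rep" where
  "separation_rep \<pi> = \<lparr>rep_space = separation (rep_space \<pi>),
     rep_act = (\<lambda>g. separation_map (rep_space \<pi>) (rep_act \<pi> g))\<rparr>"

context semi_ip
begin

lemma carrier_separation: "carrier (separation V) = null_class V ` carrier V"
  by (auto simp: separation_def null_class_def A_RCOSETS_def')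

text \<open>
  A bounded linear map sends null vectors to null vectors, so the union
  defining an induced map is a union of equal classes.
\<close>

lemma UN_null_class:
  assumes x: "x \<in> carrier V" and T: "linear_map V V T" and bd: "bounded_by V C T"
  shows "(\<Union>y\<in>null_class V x. null_class V (T y)) = null_class V (T x)"
proof -
  have "null_class V (T y) = null_class V (T x)" if "y \<in> null_class V x" for y
  proof (rule null_class_eqI)
    have y: "y \<in> carrier V" "vnorm V (y \<ominus> x) = 0" using that x by (auto simp: null_class_iff)
    show "T x \<in> carrier V" "T y \<in> carrier V" using T x y by (auto simp: linear_map_def)
    have "T y \<ominus> T x = T (y \<ominus> x)"
      using linear_map_minus[OF semi_ip_axioms semi_ip_axioms T] x y by simp
    moreover have "vnorm V (T (y \<ominus> x)) \<le> C * vnorm V (y \<ominus> x)"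
      using bd minus_closed[of y x] x y unfolding bounded_by_def by blast
    moreover have "0 \<le> vnorm V (T (y \<ominus> x))"
      using T x y by (simp add: vnorm_nonneg linear_map_def)
    ultimately show "vnorm V (T y \<ominus> T x) = 0" using y by simp
  qed
  then show ?thesis using null_class_self[OF x] by blast
qed

lemma separation_add:
  assumes "x \<in> carrier V" "y \<in> carrier V"
  shows "null_class V x \<oplus>\<^bsub>separation V\<^esub> null_class V y = null_class V (x \<oplus> y)"
  using abelian_subgroup.a_rcos_sum[OF abelian_subgroup_null_space assms]
  by (simp add: separation_def null_class_def)

lemma separation_smult:
  assumes "x \<in> carrier V"
  shows "c \<odot>\<^bsub>separation V\<^esub> null_class V x = null_class V (c \<odot> x)"
proof -
  have "linear_map V V (\<lambda>x. c \<odot> x)" "bounded_by V (cmod c) (\<lambda>x. c \<odot> x)"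
    by (auto simp: linear_map_def bounded_by_def vnorm_smult smult_r_distr smult_assoc[symmetric] mult.commute)
  from UN_null_class[OF assms this] show ?thesis by (simp add: separation_def)
qed

lemma separation_zero: "\<zero>\<^bsub>separation V\<^esub> = null_class V \<zero>"
proof -
  have "x \<in> null_space V \<longleftrightarrow> x \<in> null_class V \<zero>" for x
    using null_class_iff[of \<zero> x] by (auto simp: null_space_iff minus_conv_smult smult_0_right)
  then show ?thesis by (auto simp: separation_def)
qed

text \<open>
  By the Cauchy-Schwarz inequality null vectors are orthogonal to everything.
\<close>

lemma iprod_null_class:
  assumes "x \<in> carrier V" "y \<in> carrier V" "x' \<in> null_class V x" "y' \<in> null_class V y"
  shows "iprod V x' y' = iprod V x y"
proof -
  have *: "iprod V u' v = iprod V u v" if "u \<in> carrier V" "u' \<in> null_class V u" "v \<in> carrier V" for u u' v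
  proof -
    have u: "u' \<in> carrier V" "vnorm V (u' \<ominus> u) = 0" using that by (auto simp: null_class_iff)
    have "iprod V (u' \<ominus> u) v = 0"
      using Cauchy_Schwarz[of "u' \<ominus> u" v] u that by simp
    then show ?thesis using u that by (simp add: minus_conv_smult iprod_add iprod_smult)
  qed
  have "x' \<in> carrier V" "y' \<in> carrier V" using assms by (auto simp: null_class_iff)
  then show ?thesis using *[of x x' y'] *[of y y' x] iprod_cnj[of y x] iprod_cnj[of y' x] assms by simp
qed

lemma separation_iprod:
  assumes "x \<in> carrier V" "y \<in> carrier V"
  shows "iprod (separation V) (null_class V x) (null_class V y) = iprod V x y"
proof -
  have "(\<Union>x'\<in>null_class V x. \<Union>y'\<in>null_class V y. {iprod V x' y'}) = {iprod V x y}"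
    (is "?U = _")
  proof
    show "?U \<subseteq> {iprod V x y}" using iprod_null_class[OF assms] by blast
    show "{iprod V x y} \<subseteq> ?U" using null_class_self assms by blast
  qed
  then show ?thesis by (simp add: separation_def)
qed

lemma null_class_linear: "linear_map V (separation V) (null_class V)"
  by (auto simp: linear_map_def carrier_separation separation_add separation_smult)

lemma null_class_norm_preserving: "norm_preserving V (separation V) (null_class V)"
  by (auto simp: norm_preserving_def vnorm_def separation_iprod)

text \<open>
  Every axiom is an equation or an inequality between values of operations that the surjection onto the
  quotient respects, so it is inherited from \<open>V\<close>.
\<close>

lemma semi_ip_separation: "semi_ip (separation V)"
proof -
  note s = carrier_separation separation_add separation_smult separation_zero separation_iprod
  have "abelian_group (separation V)"
  proof (rule abelian_groupI)
    fix X assume "X \<in> carrier (separation V)"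
    then obtain x where x: "x \<in> carrier V" "X = null_class V x" by (auto simp: s)
    then show "\<exists>y\<in>carrier (separation V). y \<oplus>\<^bsub>separation V\<^esub> X = \<zero>\<^bsub>separation V\<^esub>"
      by (intro bexI[of _ "null_class V (\<ominus> x)"]) (auto simp: s l_neg)
  qed (auto simp: s a_ac)
  then show ?thesis
    by (intro semi_ip.intro semi_ip_axioms.intro)
       (auto simp: s smult_l_distr smult_r_distr smult_assoc smult_one iprod_add iprod_smult
         iprod_nonneg intro: iprod_cnj)
qed

end

lemma separation_rep_intertwiner:
  assumes \<pi>: "contractive_rep G \<pi>"
  shows contractive_separation_rep: "contractive_rep G (separation_rep \<pi>)"
    and intertwiner_null_class: "intertwiner G \<pi> (separation_rep \<pi>) (null_class (rep_space \<pi>))"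
proof -
  interpret V: semi_ip "rep_space \<pi>" using \<pi> by (simp add: contractive_rep_def)
  let ?V = "rep_space \<pi>"
  have act: "rep_act (separation_rep \<pi>) g (null_class ?V x) = null_class ?V (rep_act \<pi> g x)"
    if "g \<in> carrier G" "x \<in> carrier ?V" for g x
    using V.UN_null_class[of x "rep_act \<pi> g" 1] \<pi> that
    by (simp add: separation_rep_def separation_map_def contractive_rep_def)
  then show "intertwiner G \<pi> (separation_rep \<pi>) (null_class ?V)"
    using V.null_class_linear by (simp add: intertwiner_def separation_rep_def)
  have "vnorm (separation ?V) (null_class ?V x) = vnorm ?V x" if "x \<in> carrier ?V" for x
    using V.null_class_norm_preserving that by (simp add: norm_preserving_def)
  then show "contractive_rep G (separation_rep \<pi>)"
    using \<pi> act V.semi_ip_separation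
    by (auto simp: contractive_rep_def linear_map_def bounded_by_def V.carrier_separation
        V.separation_add V.separation_smult separation_rep_def)
qed

lemma bounded_by_separation:
  assumes \<pi>: "contractive_rep G \<pi>" and a: "a \<in> group_algebra G"
    and bd: "bounded_by (rep_space \<pi>) C (rep_ext \<pi> a)"
  shows "bounded_by (rep_space (separation_rep \<pi>)) C (rep_ext (separation_rep \<pi>) a)"
  unfolding bounded_by_def
proof
  interpret V: semi_ip "rep_space \<pi>" using \<pi> by (simp add: contractive_rep_def)
  let ?V = "rep_space \<pi>"
  have sp: "rep_space (separation_rep \<pi>) = separation ?V" by (simp add: separation_rep_def)
  have n: "vnorm (separation ?V) (null_class ?V x) = vnorm ?V x" if "x \<in> carrier ?V" for x
    using V.null_class_norm_preserving that by (simp add: norm_preserving_def)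
  fix X assume "X \<in> carrier (rep_space (separation_rep \<pi>))"
  then obtain x where x: "x \<in> carrier ?V" "X = null_class ?V x" by (auto simp: sp V.carrier_separation)
  have "rep_ext (separation_rep \<pi>) a X = null_class ?V (rep_ext \<pi> a x)"
    using rep_ext_intertwine[OF a \<pi> separation_rep_intertwiner[OF \<pi>] x(1)] x(2) by simp
  then show "vnorm (rep_space (separation_rep \<pi>)) (rep_ext (separation_rep \<pi>) a X)
      \<le> C * vnorm (rep_space (separation_rep \<pi>)) X"
    using x n rep_ext_closed[OF a \<pi>] bd by (simp add: sp bounded_by_def)
qed

section \<open>Spaces of sequences\<close>

text \<open>
  The common feature of the sum of a series and of limits along a filter.  They give the forms of
  direct sums, of the completion and of ultraproducts, which are therefore treated together.
\<close>

locale positive_functional =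
  fixes D :: "(nat \<Rightarrow> complex) set" and L :: "(nat \<Rightarrow> complex) \<Rightarrow> complex"
  assumes D_add: "f \<in> D \<Longrightarrow> g \<in> D \<Longrightarrow> (\<lambda>n. f n + g n) \<in> D"
    and D_mult: "f \<in> D \<Longrightarrow> (\<lambda>n. c * f n) \<in> D"
    and L_add: "f \<in> D \<Longrightarrow> g \<in> D \<Longrightarrow> L (\<lambda>n. f n + g n) = L f + L g"
    and L_mult: "f \<in> D \<Longrightarrow> L (\<lambda>n. c * f n) = c * L f"
    and L_cnj: "f \<in> D \<Longrightarrow> L (\<lambda>n. cnj (f n)) = cnj (L f)"
    and L_nonneg: "(\<lambda>n. of_real (r n)) \<in> D \<Longrightarrow> (\<And>n. 0 \<le> r n) \<Longrightarrow> 0 \<le> Re (L (\<lambda>n. of_real (r n)))"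

lemma positive_functional_Lim:
  assumes F: "F \<noteq> bot"
  shows "positive_functional {f. \<exists>l. (f \<longlongrightarrow> l) F} (Lim F)"
proof
  note L = tendsto_Lim[OF F]
  fix f g :: "nat \<Rightarrow> complex" and c
  assume "f \<in> {f. \<exists>l. (f \<longlongrightarrow> l) F}"
  then obtain l where l: "(f \<longlongrightarrow> l) F" by auto
  show "(\<lambda>n. c * f n) \<in> {f. \<exists>l. (f \<longlongrightarrow> l) F}" using tendsto_mult_left[OF l] by blast
  show "Lim F (\<lambda>n. c * f n) = c * Lim F f" using L[OF l] L[OF tendsto_mult_left[OF l]] by simp
  show "Lim F (\<lambda>n. cnj (f n)) = cnj (Lim F f)" using L[OF l] L[OF tendsto_cnj[OF l]] by simp
  assume "g \<in> {f. \<exists>l. (f \<longlongrightarrow> l) F}"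
  then obtain l' where l': "(g \<longlongrightarrow> l') F" by auto
  show "(\<lambda>n. f n + g n) \<in> {f. \<exists>l. (f \<longlongrightarrow> l) F}" using tendsto_add[OF l l'] by blast
  show "Lim F (\<lambda>n. f n + g n) = Lim F f + Lim F g" using L[OF l] L[OF l'] L[OF tendsto_add[OF l l']] by simp
next
  fix r :: "nat \<Rightarrow> real" assume "(\<lambda>n. complex_of_real (r n)) \<in> {f. \<exists>l. (f \<longlongrightarrow> l) F}" and r: "\<And>n. 0 \<le> r n"
  then obtain l where l: "((\<lambda>n. complex_of_real (r n)) \<longlongrightarrow> l) F" by auto
  have "(r \<longlongrightarrow> Re l) F" using tendsto_Re[OF l] by simp
  then have "0 \<le> Re l" by (rule tendsto_lowerbound) (use r F in auto)
  then show "0 \<le> Re (Lim F (\<lambda>n. complex_of_real (r n)))" using tendsto_Lim[OF F l] by simp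
qed

lemma positive_functional_suminf: "positive_functional {f. summable f} suminf"
proof
  fix r :: "nat \<Rightarrow> real" assume "(\<lambda>n. complex_of_real (r n)) \<in> {f. summable f}" and r: "\<And>n. 0 \<le> r n"
  then have sr: "summable r" using summable_Re by force
  have "(\<Sum>n. complex_of_real (r n)) = of_real (\<Sum>n. r n)" by (rule suminf_of_real[OF sr, symmetric])
  then show "0 \<le> Re (\<Sum>n. complex_of_real (r n))" using r sr by (simp add: suminf_nonneg)
next
  fix f :: "nat \<Rightarrow> complex" assume "f \<in> {f. summable f}"
  then show "(\<Sum>n. cnj (f n)) = cnj (\<Sum>n. f n)"
    using sums_cnj[of f "suminf f"] by (simp add: sums_iff summable_sums)
qed (auto simp: summable_add summable_mult suminf_add suminf_mult)

text \<open>
  Only the squared norms of sequences in \<open>S\<close> are required to lie in the domain \<open>D\<close> of the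
  functional; polarization supplies the rest.
\<close>

locale seq_ip = positive_functional D L
  for D L +
  fixes V :: "nat \<Rightarrow> 'v ip_space" and S :: "(nat \<Rightarrow> 'v) set"
  assumes V: "\<And>n. semi_ip (V n)"
    and S_sub: "\<And>s n. s \<in> S \<Longrightarrow> s n \<in> carrier (V n)"
    and S_zero: "(\<lambda>n. \<zero>\<^bsub>V n\<^esub>) \<in> S"
    and S_add: "\<And>s t. s \<in> S \<Longrightarrow> t \<in> S \<Longrightarrow> (\<lambda>n. s n \<oplus>\<^bsub>V n\<^esub> t n) \<in> S"
    and S_smult: "\<And>s c. s \<in> S \<Longrightarrow> (\<lambda>n. c \<odot>\<^bsub>V n\<^esub> s n) \<in> S"
    and S_norm: "\<And>s. s \<in> S \<Longrightarrow> (\<lambda>n. of_real ((vnorm (V n) (s n))\<^sup>2)) \<in> D"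
begin

abbreviation W :: "(nat \<Rightarrow> 'v) ip_space" where
  "W \<equiv> seq_space V S (\<lambda>s t. L (\<lambda>n. iprod (V n) (s n) (t n)))"

lemma iprod_D:
  assumes s: "s \<in> S" and t: "t \<in> S"
  shows "(\<lambda>n. iprod (V n) (s n) (t n)) \<in> D"
proof -
  have pol: "iprod (V n) (s n) (t n) =
    1/4 * of_real ((vnorm (V n) (s n \<oplus>\<^bsub>V n\<^esub> 1 \<odot>\<^bsub>V n\<^esub> t n))\<^sup>2)
    + (-1/4) * of_real ((vnorm (V n) (s n \<oplus>\<^bsub>V n\<^esub> (-1) \<odot>\<^bsub>V n\<^esub> t n))\<^sup>2)
    + (\<i>/4) * of_real ((vnorm (V n) (s n \<oplus>\<^bsub>V n\<^esub> \<i> \<odot>\<^bsub>V n\<^esub> t n))\<^sup>2)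
    + (-\<i>/4) * of_real ((vnorm (V n) (s n \<oplus>\<^bsub>V n\<^esub> (-\<i>) \<odot>\<^bsub>V n\<^esub> t n))\<^sup>2)" for n
    by (subst semi_ip.polarization[OF V S_sub[OF s] S_sub[OF t]]) (simp add: field_simps)
  show ?thesis unfolding pol
    by (intro D_add D_mult S_norm S_add S_smult s t)
qed

lemma W_simps:
  "carrier W = S" "\<zero>\<^bsub>W\<^esub> = (\<lambda>n. \<zero>\<^bsub>V n\<^esub>)" "s \<oplus>\<^bsub>W\<^esub> t = (\<lambda>n. s n \<oplus>\<^bsub>V n\<^esub> t n)"
  "c \<odot>\<^bsub>W\<^esub> s = (\<lambda>n. c \<odot>\<^bsub>V n\<^esub> s n)" "iprod W s t = L (\<lambda>n. iprod (V n) (s n) (t n))"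
  by (simp_all add: seq_space_def)

lemma semi_ip_W: "semi_ip W"
proof -
  interpret V: semi_ip "V n" for n by (rule V)
  have ab: "abelian_group W"
  proof (rule abelian_groupI, unfold W_simps, goal_cases)
    case (1 s t) then show ?case by (rule S_add)
  next
    case 2 show ?case by (rule S_zero)
  next
    case (3 s t u) then show ?case by (intro ext V.a_assoc S_sub)
  next
    case (4 s t) then show ?case by (intro ext V.a_comm S_sub)
  next
    case (5 s) then show ?case by (intro ext V.l_zero S_sub)
  next
    case (6 s)
    have "(-1) \<odot>\<^bsub>V n\<^esub> s n \<oplus>\<^bsub>V n\<^esub> s n = \<zero>\<^bsub>V n\<^esub>" for n
      using V.smult_l_distr[OF S_sub[OF 6], where c = "-1" and d = 1] V.smult_one[OF S_sub[OF 6]]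
        V.smult_0_left[OF S_sub[OF 6]] by simp
    then show ?case by (intro bexI[OF _ S_smult[OF 6, of "-1"]]) simp
  qed
  show ?thesis
  proof (rule semi_ip.intro[OF ab], rule semi_ip_axioms.intro, unfold W_simps, goal_cases)
    case (1 s c) then show ?case by (rule S_smult)
  next
    case (2 s c d) then show ?case by (intro ext V.smult_l_distr S_sub)
  next
    case (3 s t c) then show ?case by (intro ext V.smult_r_distr S_sub)
  next
    case (4 s c d) then show ?case by (intro ext V.smult_assoc S_sub)
  next
    case (5 s) then show ?case by (intro ext V.smult_one S_sub)
  next
    case (6 s t u)
    then show ?case
      using L_add[OF iprod_D[OF 6(1,3)] iprod_D[OF 6(2,3)]]
      by (simp add: V.iprod_add[OF S_sub S_sub S_sub])
  next
    case (7 s t c)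
    then show ?case
      using L_mult[OF iprod_D[OF 7]] by (simp add: V.iprod_smult[OF S_sub S_sub])
  next
    case (8 s t)
    then have "(\<lambda>n. iprod (V n) (t n) (s n)) = (\<lambda>n. cnj (iprod (V n) (s n) (t n)))"
      by (intro ext V.iprod_cnj S_sub)
    then show ?case using L_cnj[OF iprod_D[OF 8]] by simp
  next
    case (9 s)
    then show ?case
      using L_nonneg[OF S_norm[OF 9]] by (simp add: V.iprod_self[OF S_sub[OF 9]])
  qed
qed

lemma vnorm_W_sq:
  assumes s: "s \<in> S"
  shows "(vnorm W s)\<^sup>2 = Re (L (\<lambda>n. of_real ((vnorm (V n) (s n))\<^sup>2)))"
proof -
  have 1: "iprod W s s = L (\<lambda>n. of_real ((vnorm (V n) (s n))\<^sup>2))"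
    by (simp only: W_simps semi_ip.iprod_self[OF V S_sub[OF s]])
  have 2: "iprod W s s = of_real ((vnorm W s)\<^sup>2)"
    by (rule semi_ip.iprod_self[OF semi_ip_W]) (simp add: W_simps s)
  from arg_cong[OF trans[OF 2[symmetric] 1], of Re] show ?thesis unfolding Re_complex_of_real .
qed

text \<open>
  Positivity makes \<open>L\<close> monotone, so termwise norm inequalities between sequences become
  inequalities between their norms.
\<close>

lemma vnorm_W_mono:
  assumes s: "s \<in> S" and t: "t \<in> S" and C: "0 \<le> C"
    and le: "\<And>n. vnorm (V n) (s n) \<le> C * vnorm (V n) (t n)"
  shows "vnorm W s \<le> C * vnorm W t"
proof (rule power2_le_imp_le)
  let ?f = "\<lambda>n. complex_of_real ((vnorm (V n) (s n))\<^sup>2)"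
  let ?g = "\<lambda>n. complex_of_real ((vnorm (V n) (t n))\<^sup>2)"
  let ?r = "\<lambda>n. C\<^sup>2 * (vnorm (V n) (t n))\<^sup>2 - (vnorm (V n) (s n))\<^sup>2"
  have D: "?f \<in> D" "?g \<in> D" using S_norm s t by auto
  have r: "(\<lambda>n. of_real (?r n)) = (\<lambda>n. of_real (C\<^sup>2) * ?g n + (-1) * ?f n)" by simp
  have "0 \<le> ?r n" for n
    using power_mono[OF le[of n], of 2] semi_ip.vnorm_nonneg[OF V S_sub[OF s]]
    by (simp add: power_mult_distrib)
  then have "0 \<le> Re (L (\<lambda>n. of_real (?r n)))"
    by (intro L_nonneg) (unfold r, intro D_add D_mult D)
  also have "L (\<lambda>n. of_real (?r n)) = of_real (C\<^sup>2) * L ?g + (-1) * L ?f"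
    unfolding r by (subst L_add, (intro D_mult D)+) (simp only: L_mult D)
  finally show "(vnorm W s)\<^sup>2 \<le> (C * vnorm W t)\<^sup>2"
    by (simp add: vnorm_W_sq[OF s] vnorm_W_sq[OF t] power_mult_distrib)
  show "0 \<le> C * vnorm W t" using C t semi_ip.vnorm_nonneg[OF semi_ip_W, of t] by (simp add: W_simps)
qed

lemma linear_map_eval: "linear_map W (V n) (\<lambda>s. s n)"
  by (auto simp: linear_map_def seq_space_def S_sub)

lemma W_minus: "s \<in> S \<Longrightarrow> t \<in> S \<Longrightarrow> (s \<ominus>\<^bsub>W\<^esub> t) n = s n \<ominus>\<^bsub>V n\<^esub> t n"
  using linear_map_minus[OF semi_ip_W V linear_map_eval, of s t n] by (simp add: W_simps)

end

text \<open>
  The space \<open>U\<close> is a parameter because one termwise action serves square-summable,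
  bounded and Cauchy sequences alike.
\<close>

definition seq_rep ::
  "(nat \<Rightarrow> ('g, 'v) rep) \<Rightarrow> (nat \<Rightarrow> 'v) ip_space \<Rightarrow> ('g, nat \<Rightarrow> 'v) rep" where
  "seq_rep \<rho> U = \<lparr>rep_space = U, rep_act = (\<lambda>g \<xi> n. rep_act (\<rho> n) g (\<xi> n))\<rparr>"

locale seq_ip_rep = seq_ip D L "\<lambda>n. rep_space (\<rho> n)" S
  for G :: "('g, 'b) monoid_scheme" and D L and \<rho> :: "nat \<Rightarrow> ('g, 'v) rep" and S +
  assumes \<rho>: "\<And>n. contractive_rep G (\<rho> n)"
    and S_act: "\<And>g s. g \<in> carrier G \<Longrightarrow> s \<in> S \<Longrightarrow> (\<lambda>n. rep_act (\<rho> n) g (s n)) \<in> S"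
begin

lemma contractive_seq_rep: "contractive_rep G (seq_rep \<rho> W)"
  unfolding contractive_rep_def
proof (intro conjI ballI)
  show "semi_ip (rep_space (seq_rep \<rho> W))" using semi_ip_W by (simp add: seq_rep_def)
  fix g assume g: "g \<in> carrier G"
  then have lin: "linear_map (rep_space (\<rho> n)) (rep_space (\<rho> n)) (rep_act (\<rho> n) g)"
    and bd: "bounded_by (rep_space (\<rho> n)) 1 (rep_act (\<rho> n) g)" for n
    using \<rho>[of n] by (auto simp: contractive_rep_def)
  show "linear_map (rep_space (seq_rep \<rho> W)) (rep_space (seq_rep \<rho> W)) (rep_act (seq_rep \<rho> W) g)"
    using S_act[OF g] linear_mapD[OF lin] S_sub by (auto simp: linear_map_def seq_rep_def seq_space_def)
  show "bounded_by (rep_space (seq_rep \<rho> W)) 1 (rep_act (seq_rep \<rho> W) g)"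
    unfolding bounded_by_def
  proof
    fix s assume "s \<in> carrier (rep_space (seq_rep \<rho> W))"
    then have s: "s \<in> S" by (simp add: seq_rep_def seq_space_def)
    have "vnorm W (\<lambda>n. rep_act (\<rho> n) g (s n)) \<le> 1 * vnorm W s"
      by (rule vnorm_W_mono[OF S_act[OF g s] s]) (use bd S_sub[OF s] in \<open>auto simp: bounded_by_def\<close>)
    then show "vnorm (rep_space (seq_rep \<rho> W)) (rep_act (seq_rep \<rho> W) g s) \<le> 1 * vnorm (rep_space (seq_rep \<rho> W)) s"
      by (simp add: seq_rep_def)
  qed
qed

text \<open>
  Evaluation at each index is an intertwiner.
\<close>

lemma rep_ext_seq_rep:
  assumes a: "a \<in> group_algebra G" and s: "s \<in> S"
  shows "rep_ext (seq_rep \<rho> W) a s = (\<lambda>n. rep_ext (\<rho> n) a (s n))"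
proof
  fix n
  have "intertwiner G (seq_rep \<rho> W) (\<rho> n) (\<lambda>s. s n)"
    using linear_map_eval by (simp add: intertwiner_def seq_rep_def)
  from rep_ext_intertwine[OF a contractive_seq_rep \<rho> this, of s] s
  show "rep_ext (seq_rep \<rho> W) a s n = rep_ext (\<rho> n) a (s n)" by (simp add: seq_rep_def seq_space_def)
qed

lemma bounded_by_seq_rep:
  assumes a: "a \<in> group_algebra G" and C: "0 \<le> C"
    and bd: "\<And>n. bounded_by (rep_space (\<rho> n)) C (rep_ext (\<rho> n) a)"
  shows "bounded_by (rep_space (seq_rep \<rho> W)) C (rep_ext (seq_rep \<rho> W) a)"
  unfolding bounded_by_def
proof
  have sp: "rep_space (seq_rep \<rho> W) = W" by (simp add: seq_rep_def)
  fix s assume s': "s \<in> carrier (rep_space (seq_rep \<rho> W))"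
  then have s: "s \<in> S" by (simp add: seq_rep_def seq_space_def)
  have "rep_ext (seq_rep \<rho> W) a s \<in> S"
    using rep_ext_closed[OF a contractive_seq_rep s'] by (simp add: sp) (simp add: seq_space_def)
  then show "vnorm (rep_space (seq_rep \<rho> W)) (rep_ext (seq_rep \<rho> W) a s) \<le> C * vnorm (rep_space (seq_rep \<rho> W)) s"
    unfolding sp
    by (rule vnorm_W_mono[OF _ s C]) (use bd S_sub[OF s] in \<open>auto simp: rep_ext_seq_rep[OF a s] bounded_by_def\<close>)
qed

end

section \<open>Hilbert space direct sums\<close>

lemma seq_ip_rep_direct_sum:
  assumes \<rho>: "\<And>n. contractive_rep G (\<rho> n)"
  shows "seq_ip_rep G {f. summable f} suminf \<rho>
    {\<xi>. (\<forall>n. \<xi> n \<in> carrier (rep_space (\<rho> n))) \<and> summable (\<lambda>n. (vnorm (rep_space (\<rho> n)) (\<xi> n))\<^sup>2)}"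
proof (intro seq_ip_rep.intro seq_ip.intro seq_ip_axioms.intro seq_ip_rep_axioms.intro, goal_cases)
  have V: "semi_ip (rep_space (\<rho> n))" for n using \<rho> by (simp add: contractive_rep_def)
  interpret V: semi_ip "rep_space (\<rho> n)" for n by (rule V)
  {
    case 1 show ?case by (rule positive_functional_suminf)
  next
    case (2 n) show ?case by (rule V)
  next
    case (3 s n) then show ?case by simp
  next
    case 4 show ?case by simp
  next
    case (5 s t)
    have "summable (\<lambda>n. (vnorm (rep_space (\<rho> n)) (s n \<oplus>\<^bsub>rep_space (\<rho> n)\<^esub> t n))\<^sup>2)"
    proof (rule summable_comparison_test')
      show "summable (\<lambda>n. 2 * (vnorm (rep_space (\<rho> n)) (s n))\<^sup>2 + 2 * (vnorm (rep_space (\<rho> n)) (t n))\<^sup>2)"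
        using 5 by (intro summable_add summable_mult) auto
      fix n
      let ?s = "vnorm (rep_space (\<rho> n)) (s n)" and ?t = "vnorm (rep_space (\<rho> n)) (t n)"
      have c: "s n \<in> carrier (rep_space (\<rho> n))" "t n \<in> carrier (rep_space (\<rho> n))" using 5 by auto
      have "(vnorm (rep_space (\<rho> n)) (s n \<oplus>\<^bsub>rep_space (\<rho> n)\<^esub> t n))\<^sup>2 \<le> (?s + ?t)\<^sup>2"
        using V.vnorm_triangle[OF c] V.vnorm_nonneg[OF V.a_closed[OF c]] by (rule power_mono)
      also have "\<dots> \<le> 2 * ?s\<^sup>2 + 2 * ?t\<^sup>2"
        using zero_le_power2[of "?s - ?t"] by (simp add: power2_sum power2_diff)
      finally show "norm ((vnorm (rep_space (\<rho> n)) (s n \<oplus>\<^bsub>rep_space (\<rho> n)\<^esub> t n))\<^sup>2) \<le> 2 * ?s\<^sup>2 + 2 * ?t\<^sup>2"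
        by simp
    qed
    with 5 show ?case by simp
  next
    case (6 s c)
    then show ?case by (simp add: V.vnorm_smult power_mult_distrib summable_mult)
  next
    case (7 s)
    then show ?case using summable_of_real[of "\<lambda>n. (vnorm (rep_space (\<rho> n)) (s n))\<^sup>2"] by auto
  next
    case (8 n) show ?case by (rule \<rho>)
  next
    case (9 g s)
    have act: "rep_act (\<rho> n) g (s n) \<in> carrier (rep_space (\<rho> n))"
      "vnorm (rep_space (\<rho> n)) (rep_act (\<rho> n) g (s n)) \<le> vnorm (rep_space (\<rho> n)) (s n)" for n
      using \<rho>[of n] 9 by (auto simp: contractive_rep_def linear_map_def bounded_by_def)
    have "summable (\<lambda>n. (vnorm (rep_space (\<rho> n)) (rep_act (\<rho> n) g (s n)))\<^sup>2)"
    proof (rule summable_comparison_test')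
      show "summable (\<lambda>n. (vnorm (rep_space (\<rho> n)) (s n))\<^sup>2)" using 9 by simp
      show "norm ((vnorm (rep_space (\<rho> n)) (rep_act (\<rho> n) g (s n)))\<^sup>2) \<le> (vnorm (rep_space (\<rho> n)) (s n))\<^sup>2" for n
        using power_mono[OF act(2)[of n] V.vnorm_nonneg[OF act(1)[of n]], of 2] by simp
    qed
    with act show ?case by simp
  }
qed

lemma direct_sum_rep_eq:
  "direct_sum_rep \<rho> = seq_rep \<rho> (direct_sum_space (\<lambda>n. rep_space (\<rho> n)))"
  by (simp add: direct_sum_rep_def seq_rep_def)

lemma contractive_direct_sum_rep:
  assumes "\<And>n. contractive_rep G (\<rho> n)"
  shows "contractive_rep G (direct_sum_rep \<rho>)"
  using seq_ip_rep.contractive_seq_rep[OF seq_ip_rep_direct_sum, of G \<rho>] assms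
  by (simp add: direct_sum_rep_eq direct_sum_space_def)

lemma bounded_by_direct_sum_rep:
  assumes "\<And>n. contractive_rep G (\<rho> n)" "a \<in> group_algebra G" "0 \<le> C"
    "\<And>n. bounded_by (rep_space (\<rho> n)) C (rep_ext (\<rho> n) a)"
  shows "bounded_by (rep_space (direct_sum_rep \<rho>)) C (rep_ext (direct_sum_rep \<rho>) a)"
  using seq_ip_rep.bounded_by_seq_rep[OF seq_ip_rep_direct_sum, of G \<rho> a C] assms
  by (simp add: direct_sum_rep_eq direct_sum_space_def)

lemma direct_sum_inclusion:
  fixes \<rho> :: "nat \<Rightarrow> ('g, 'v) rep" and m :: nat
  assumes \<rho>: "\<And>n. contractive_rep G (\<rho> n)"
  defines "J \<equiv> \<lambda>x n. if n = m then x else \<zero>\<^bsub>rep_space (\<rho> n)\<^esub>"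
  shows intertwiner_direct_sum_inclusion: "intertwiner G (\<rho> m) (direct_sum_rep \<rho>) J"
    and norm_direct_sum_inclusion:
      "norm_preserving (rep_space (\<rho> m)) (rep_space (direct_sum_rep \<rho>)) J"
proof -
  have V: "semi_ip (rep_space (\<rho> n))" for n using \<rho> by (simp add: contractive_rep_def)
  interpret V: semi_ip "rep_space (\<rho> n)" for n by (rule V)
  have sq: "(\<lambda>n. (vnorm (rep_space (\<rho> n)) (J x n))\<^sup>2) sums ((vnorm (rep_space (\<rho> m)) x)\<^sup>2)" for x
    using sums_single[of m "\<lambda>n. (vnorm (rep_space (\<rho> m)) x)\<^sup>2"]
    by (rule sums_cong[THEN iffD1, rotated]) (simp add: J_def)
  have car: "J x \<in> carrier (direct_sum_space (\<lambda>n. rep_space (\<rho> n)))" if "x \<in> carrier (rep_space (\<rho> m))" for x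
    using that sums_summable[OF sq[of x]] by (auto simp: direct_sum_space_def seq_space_def J_def)
  have zero: "rep_act (\<rho> n) g \<zero>\<^bsub>rep_space (\<rho> n)\<^esub> = \<zero>\<^bsub>rep_space (\<rho> n)\<^esub>" if "g \<in> carrier G" for g n
    using linear_map_zero[OF V V] \<rho>[of n] that by (auto simp: contractive_rep_def)
  show "intertwiner G (\<rho> m) (direct_sum_rep \<rho>) J"
    using car zero
    by (auto simp: intertwiner_def linear_map_def direct_sum_rep_def)
       (auto simp: direct_sum_space_def seq_space_def J_def V.smult_0_right fun_eq_iff)
  show "norm_preserving (rep_space (\<rho> m)) (rep_space (direct_sum_rep \<rho>)) J"
    unfolding norm_preserving_def
  proof
    fix x assume x: "x \<in> carrier (rep_space (\<rho> m))"
    interpret S: seq_ip_rep G "{f. summable f}" suminf \<rho>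
      "{\<xi>. (\<forall>n. \<xi> n \<in> carrier (rep_space (\<rho> n))) \<and> summable (\<lambda>n. (vnorm (rep_space (\<rho> n)) (\<xi> n))\<^sup>2)}"
      by (rule seq_ip_rep_direct_sum[OF \<rho>])
    have "(vnorm S.W (J x))\<^sup>2 = Re (\<Sum>n. of_real ((vnorm (rep_space (\<rho> n)) (J x n))\<^sup>2))"
      using car[OF x] by (intro S.vnorm_W_sq) (simp add: direct_sum_space_def seq_space_def)
    also have "\<dots> = (vnorm (rep_space (\<rho> m)) x)\<^sup>2"
      using sums_unique[OF sums_of_real[OF sq[of x], where 'a = complex]]
      by (metis Re_complex_of_real)
    finally have "(vnorm S.W (J x))\<^sup>2 = (vnorm (rep_space (\<rho> m)) x)\<^sup>2" .
    moreover have "0 \<le> vnorm S.W (J x)"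
      using car[OF x] by (intro semi_ip.vnorm_nonneg[OF S.semi_ip_W]) (simp add: direct_sum_space_def)
    ultimately show "vnorm (rep_space (direct_sum_rep \<rho>)) (J x) = vnorm (rep_space (\<rho> m)) x"
      using V.vnorm_nonneg[OF x] by (simp add: direct_sum_rep_def direct_sum_space_def)
  qed
qed

section \<open>Bounded sequences\<close>

definition bounded_rep :: "nat filter \<Rightarrow> (nat \<Rightarrow> ('g, 'v) rep) \<Rightarrow> ('g, nat \<Rightarrow> 'v) rep" where
  "bounded_rep \<U> \<rho> = seq_rep \<rho> (bounded_space \<U> (\<lambda>n. rep_space (\<rho> n)))"

text \<open>
  The limit is the supremum of the numbers \<open>x\<close> with \<open>x \<le> r n\<close> for \<open>\<U>\<close>-almost all
  \<open>n\<close>; any larger number \<open>c\<close> fails this, so the ultrafilter decides for \<open>r n < c\<close>.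
\<close>

lemma ultrafilter_bounded_convergent:
  fixes r :: "nat \<Rightarrow> real"
  assumes U: "nonprincipal_ultrafilter \<U>" and r: "\<And>n. b \<le> r n" "\<And>n. r n \<le> B"
  shows "\<exists>l. (r \<longlongrightarrow> l) \<U>"
proof -
  define A where "A = {x. eventually (\<lambda>n. x \<le> r n) \<U>}"
  have nt: "\<U> \<noteq> bot" and ultra: "\<And>P. eventually P \<U> \<or> eventually (\<lambda>n. \<not> P n) \<U>"
    using U by (auto simp: nonprincipal_ultrafilter_def)
  have ne: "A \<noteq> {}" using r(1) by (auto simp: A_def intro!: exI[of _ b])
  have up: "x \<le> B" if "x \<in> A" for x
    using eventually_happens'[OF nt] that r(2) order_trans unfolding A_def by blast
  then have bdd: "bdd_above A" by (rule bdd_aboveI)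
  have "(r \<longlongrightarrow> Sup A) \<U>"
  proof (rule order_tendstoI)
    fix a assume "a < Sup A"
    then obtain x where "x \<in> A" "a < x" using less_cSup_iff[OF ne bdd] by blast
    then show "eventually (\<lambda>n. a < r n) \<U>" by (auto simp: A_def elim: eventually_mono)
  next
    fix c assume "Sup A < c"
    then have "c \<notin> A" using cSup_upper[OF _ bdd] by force
    then have "eventually (\<lambda>n. \<not> c \<le> r n) \<U>" using ultra by (auto simp: A_def)
    then show "eventually (\<lambda>n. r n < c) \<U>" by (simp add: not_le)
  qed
  then show ?thesis ..
qed

lemma nonprincipal_eventually_ge:
  assumes "nonprincipal_ultrafilter \<U>"
  shows "eventually (\<lambda>n. m \<le> n) \<U>"
proof (induction m)
  case (Suc m)
  have "eventually (\<lambda>n. n \<noteq> m) \<U>" using assms by (auto simp: nonprincipal_ultrafilter_def)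
  with Suc show ?case by eventually_elim auto
qed simp

lemma seq_ip_rep_bounded:
  assumes U: "nonprincipal_ultrafilter \<U>" and \<rho>: "\<And>n. contractive_rep G (\<rho> n)"
  shows "seq_ip_rep G {f. \<exists>l. (f \<longlongrightarrow> l) \<U>} (Lim \<U>) \<rho>
    {\<xi>. (\<forall>n. \<xi> n \<in> carrier (rep_space (\<rho> n))) \<and> bdd_above (range (\<lambda>n. vnorm (rep_space (\<rho> n)) (\<xi> n)))}"
proof (intro seq_ip_rep.intro seq_ip.intro seq_ip_axioms.intro seq_ip_rep_axioms.intro, goal_cases)
  have V: "semi_ip (rep_space (\<rho> n))" for n using \<rho> by (simp add: contractive_rep_def)
  interpret V: semi_ip "rep_space (\<rho> n)" for n by (rule V)
  {
    case 1 show ?case by (rule positive_functional_Lim) (use U in \<open>simp add: nonprincipal_ultrafilter_def\<close>)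
  next
    case (2 n) show ?case by (rule V)
  next
    case (3 s n) then show ?case by simp
  next
    case 4 show ?case by simp
  next
    case (5 s t)
    then obtain B C where c: "\<And>n. s n \<in> carrier (rep_space (\<rho> n))" "\<And>n. t n \<in> carrier (rep_space (\<rho> n))"
      and B: "\<And>n. vnorm (rep_space (\<rho> n)) (s n) \<le> B" and C: "\<And>n. vnorm (rep_space (\<rho> n)) (t n) \<le> C"
      by (auto simp: bdd_above_def)
    have "vnorm (rep_space (\<rho> n)) (s n \<oplus>\<^bsub>rep_space (\<rho> n)\<^esub> t n) \<le> B + C" for n
      using V.vnorm_triangle[OF c(1)[of n] c(2)[of n]] B[of n] C[of n] by linarith
    with c show ?case by (auto intro!: bdd_aboveI2)
  next
    case (6 s c)
    then obtain B where k: "\<And>n. s n \<in> carrier (rep_space (\<rho> n))"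
      and B: "\<And>n. vnorm (rep_space (\<rho> n)) (s n) \<le> B"
      by (auto simp: bdd_above_def)
    have "vnorm (rep_space (\<rho> n)) (c \<odot>\<^bsub>rep_space (\<rho> n)\<^esub> s n) \<le> cmod c * B" for n
      using k B[of n] by (simp add: V.vnorm_smult mult_left_mono)
    with k show ?case by (auto intro!: bdd_aboveI2)
  next
    case (7 s)
    then obtain B where k: "\<And>n. s n \<in> carrier (rep_space (\<rho> n))"
      and B: "\<And>n. vnorm (rep_space (\<rho> n)) (s n) \<le> B"
      by (auto simp: bdd_above_def)
    obtain l where "((\<lambda>n. (vnorm (rep_space (\<rho> n)) (s n))\<^sup>2) \<longlongrightarrow> l) \<U>"
      using ultrafilter_bounded_convergent[OF U, of 0 "\<lambda>n. (vnorm (rep_space (\<rho> n)) (s n))\<^sup>2" "B\<^sup>2"]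
        power_mono[OF B V.vnorm_nonneg[OF k], of _ 2] by auto
    then show ?case using tendsto_of_real by blast
  next
    case (8 n) show ?case by (rule \<rho>)
  next
    case (9 g s)
    then obtain B where B: "\<And>n. vnorm (rep_space (\<rho> n)) (s n) \<le> B"
      by (auto simp: bdd_above_def)
    have act: "rep_act (\<rho> n) g (s n) \<in> carrier (rep_space (\<rho> n))"
      "vnorm (rep_space (\<rho> n)) (rep_act (\<rho> n) g (s n)) \<le> vnorm (rep_space (\<rho> n)) (s n)" for n
      using \<rho>[of n] 9 by (auto simp: contractive_rep_def linear_map_def bounded_by_def)
    with B order_trans have "vnorm (rep_space (\<rho> n)) (rep_act (\<rho> n) g (s n)) \<le> B" for n by blast
    with act show ?case by (auto intro!: bdd_aboveI2)
  }
qed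

lemma contractive_bounded_rep:
  assumes "nonprincipal_ultrafilter \<U>" "\<And>n. contractive_rep G (\<rho> n)"
  shows "contractive_rep G (bounded_rep \<U> \<rho>)"
  using seq_ip_rep.contractive_seq_rep[OF seq_ip_rep_bounded, of \<U> G \<rho>] assms
  by (simp add: bounded_rep_def bounded_space_def)

lemma bounded_by_bounded_rep:
  assumes "nonprincipal_ultrafilter \<U>" "\<And>n. contractive_rep G (\<rho> n)" "a \<in> group_algebra G" "0 \<le> C"
    "\<And>n. bounded_by (rep_space (\<rho> n)) C (rep_ext (\<rho> n) a)"
  shows "bounded_by (rep_space (bounded_rep \<U> \<rho>)) C (rep_ext (bounded_rep \<U> \<rho>) a)"
  using seq_ip_rep.bounded_by_seq_rep[OF seq_ip_rep_bounded, of \<U> G \<rho> a C] assms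
  by (simp add: bounded_rep_def bounded_space_def)

text \<open>
  The norm of the sequence \<open>(K n x)\<close> is a limit along \<open>\<U>\<close>, so isometry of \<open>K n\<close> matters
  for \<open>\<U>\<close>-almost all \<open>n\<close>, whereas boundedness of the sequence is a condition on all indices.
\<close>

lemma bounded_rep_inclusion:
  fixes \<rho> :: "nat \<Rightarrow> ('g, 'v) rep" and \<sigma> :: "('g, 'w) rep"
  assumes U: "nonprincipal_ultrafilter \<U>" and \<rho>: "\<And>n. contractive_rep G (\<rho> n)"
    and \<sigma>: "contractive_rep G \<sigma>"
    and K: "\<And>n. intertwiner G \<sigma> (\<rho> n) (K n)"
    and le: "\<And>n x. x \<in> carrier (rep_space \<sigma>) \<Longrightarrow> vnorm (rep_space (\<rho> n)) (K n x) \<le> vnorm (rep_space \<sigma>) x"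
    and ev: "eventually (\<lambda>n. norm_preserving (rep_space \<sigma>) (rep_space (\<rho> n)) (K n)) \<U>"
  defines "J \<equiv> \<lambda>x n. K n x"
  shows intertwiner_bounded_rep_inclusion: "intertwiner G \<sigma> (bounded_rep \<U> \<rho>) J"
    and norm_bounded_rep_inclusion: "norm_preserving (rep_space \<sigma>) (rep_space (bounded_rep \<U> \<rho>)) J"
proof -
  let ?S = "{\<xi>. (\<forall>n. \<xi> n \<in> carrier (rep_space (\<rho> n))) \<and> bdd_above (range (\<lambda>n. vnorm (rep_space (\<rho> n)) (\<xi> n)))}"
  interpret S: seq_ip_rep G "{f. \<exists>l. (f \<longlongrightarrow> l) \<U>}" "Lim \<U>" \<rho> ?S
    by (rule seq_ip_rep_bounded[OF U \<rho>])
  have sp: "rep_space (bounded_rep \<U> \<rho>) = S.W"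
    by (simp add: bounded_rep_def seq_rep_def bounded_space_def)
  have act: "rep_act (bounded_rep \<U> \<rho>) = (\<lambda>g \<xi> n. rep_act (\<rho> n) g (\<xi> n))"
    by (simp add: bounded_rep_def seq_rep_def)
  have lin: "linear_map (rep_space \<sigma>) (rep_space (\<rho> n)) (K n)" for n
    using K by (simp add: intertwiner_def)
  have car: "J x \<in> ?S" if x: "x \<in> carrier (rep_space \<sigma>)" for x
    using linear_mapD(1)[OF lin x] le[OF x] by (auto simp: J_def intro!: bdd_aboveI2)
  show "intertwiner G \<sigma> (bounded_rep \<U> \<rho>) J"
    unfolding intertwiner_def linear_map_def sp act S.W_simps
  proof (intro conjI ballI allI)
    fix x assume x: "x \<in> carrier (rep_space \<sigma>)"
    show "J x \<in> ?S" by (rule car[OF x])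
    show "J (c \<odot>\<^bsub>rep_space \<sigma>\<^esub> x) = (\<lambda>n. c \<odot>\<^bsub>rep_space (\<rho> n)\<^esub> J x n)" for c
      using linear_mapD(3)[OF lin x] by (simp add: J_def)
    show "J (x \<oplus>\<^bsub>rep_space \<sigma>\<^esub> y) = (\<lambda>n. J x n \<oplus>\<^bsub>rep_space (\<rho> n)\<^esub> J y n)" if "y \<in> carrier (rep_space \<sigma>)" for y
      using linear_mapD(2)[OF lin x that] by (simp add: J_def)
    show "J (rep_act \<sigma> g x) = (\<lambda>n. rep_act (\<rho> n) g (J x n))" if "g \<in> carrier G" for g
      using K x that by (simp add: J_def intertwiner_def)
  qed
  show "norm_preserving (rep_space \<sigma>) (rep_space (bounded_rep \<U> \<rho>)) J"
    unfolding norm_preserving_def sp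
  proof
    fix x assume x: "x \<in> carrier (rep_space \<sigma>)"
    let ?f = "\<lambda>n. complex_of_real ((vnorm (rep_space (\<rho> n)) (J x n))\<^sup>2)"
    let ?c = "complex_of_real ((vnorm (rep_space \<sigma>) x)\<^sup>2)"
    have "eventually (\<lambda>n. ?f n = ?c) \<U>"
      using ev by eventually_elim (use x in \<open>simp add: J_def norm_preserving_def\<close>)
    then have "(?f \<longlongrightarrow> ?c) \<U>" by (rule tendsto_eventually)
    then have "Lim \<U> ?f = ?c" using U by (intro tendsto_Lim) (simp_all add: nonprincipal_ultrafilter_def)
    then have "(vnorm S.W (J x))\<^sup>2 = Re ?c" using S.vnorm_W_sq[OF car[OF x]] by simp
    then have "(vnorm S.W (J x))\<^sup>2 = (vnorm (rep_space \<sigma>) x)\<^sup>2" by (simp only: Re_complex_of_real)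
    moreover have "0 \<le> vnorm S.W (J x)"
      using car[OF x] by (intro semi_ip.vnorm_nonneg[OF S.semi_ip_W]) (simp only: S.W_simps)
    moreover have "0 \<le> vnorm (rep_space \<sigma>) x"
      using \<sigma> x by (auto simp: contractive_rep_def intro: semi_ip.vnorm_nonneg)
    ultimately show "vnorm S.W (J x) = vnorm (rep_space \<sigma>) x" by simp
  qed
qed

section \<open>Completions\<close>

definition cauchy_rep :: "('g, 'v) rep \<Rightarrow> ('g, nat \<Rightarrow> 'v) rep" where
  "cauchy_rep \<pi> = seq_rep (\<lambda>_. \<pi>) (cauchy_space (rep_space \<pi>))"

lemma cauchy_seqsI:
  assumes "\<And>k. s k \<in> carrier V" "\<And>\<epsilon>. \<epsilon> > 0 \<Longrightarrow> \<exists>M. \<forall>k\<ge>M. \<forall>l\<ge>M. vnorm V (s k \<ominus>\<^bsub>V\<^esub> s l) < \<epsilon>"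
  shows "s \<in> cauchy_seqs V"
  using assms by (simp add: cauchy_seqs_def)

lemma cauchy_seqsD:
  assumes "s \<in> cauchy_seqs V"
  shows "s k \<in> carrier V" "\<epsilon> > 0 \<Longrightarrow> \<exists>M. \<forall>k\<ge>M. \<forall>l\<ge>M. vnorm V (s k \<ominus>\<^bsub>V\<^esub> s l) < \<epsilon>"
  using assms by (simp_all add: cauchy_seqs_def)

lemma seq_ip_rep_cauchy:
  assumes \<pi>: "contractive_rep G \<pi>"
  shows "seq_ip_rep G {f. \<exists>l. f \<longlonglongrightarrow> l} lim (\<lambda>_. \<pi>) (cauchy_seqs (rep_space \<pi>))"
proof (intro seq_ip_rep.intro seq_ip.intro seq_ip_axioms.intro seq_ip_rep_axioms.intro, goal_cases)
  let ?V = "rep_space \<pi>"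
  have V: "semi_ip ?V" using \<pi> by (simp add: contractive_rep_def)
  interpret V: semi_ip ?V by (rule V)
  {
    case 1 show ?case by (rule positive_functional_Lim) simp
  next
    case (2 n) show ?case by (rule V)
  next
    case (3 s n) then show ?case by (rule cauchy_seqsD)
  next
    case 4 show ?case by (simp add: cauchy_seqs_def V.minus_self)
  next
    case (5 s t)
    note s = cauchy_seqsD[OF 5(1)] and t = cauchy_seqsD[OF 5(2)]
    show ?case
    proof (rule cauchy_seqsI)
      fix \<epsilon> :: real assume "\<epsilon> > 0"
      then have e: "\<epsilon> / 2 > 0" by simp
      obtain M where M: "\<And>k l. k \<ge> M \<Longrightarrow> l \<ge> M \<Longrightarrow> vnorm ?V (s k \<ominus>\<^bsub>?V\<^esub> s l) < \<epsilon> / 2"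
        using s(2)[OF e] by blast
      obtain M' where M': "\<And>k l. k \<ge> M' \<Longrightarrow> l \<ge> M' \<Longrightarrow> vnorm ?V (t k \<ominus>\<^bsub>?V\<^esub> t l) < \<epsilon> / 2"
        using t(2)[OF e] by blast
      have "vnorm ?V ((s k \<oplus>\<^bsub>?V\<^esub> t k) \<ominus>\<^bsub>?V\<^esub> (s l \<oplus>\<^bsub>?V\<^esub> t l)) < \<epsilon>" if "k \<ge> max M M'" "l \<ge> max M M'" for k l
      proof -
        have "(s k \<oplus>\<^bsub>?V\<^esub> t k) \<ominus>\<^bsub>?V\<^esub> (s l \<oplus>\<^bsub>?V\<^esub> t l) = (s k \<ominus>\<^bsub>?V\<^esub> s l) \<oplus>\<^bsub>?V\<^esub> (t k \<ominus>\<^bsub>?V\<^esub> t l)"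
          using s(1) t(1) by (simp add: V.minus_conv_smult V.smult_r_distr V.a_ac)
        then show ?thesis
          using V.vnorm_triangle[of "s k \<ominus>\<^bsub>?V\<^esub> s l" "t k \<ominus>\<^bsub>?V\<^esub> t l"] M[of k l] M'[of k l] s(1) t(1) that
          by simp
      qed
      then show "\<exists>M. \<forall>k\<ge>M. \<forall>l\<ge>M. vnorm ?V ((s k \<oplus>\<^bsub>?V\<^esub> t k) \<ominus>\<^bsub>?V\<^esub> (s l \<oplus>\<^bsub>?V\<^esub> t l)) < \<epsilon>" by blast
    qed (use s t in auto)
  next
    case (6 s c)
    note s = cauchy_seqsD[OF 6]
    show ?case
    proof (rule cauchy_seqsI)
      fix \<epsilon> :: real assume e: "\<epsilon> > 0"
      have c: "cmod c + 1 > 0" using norm_ge_zero[of c] by linarith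
      obtain M where M: "\<And>k l. k \<ge> M \<Longrightarrow> l \<ge> M \<Longrightarrow> vnorm ?V (s k \<ominus>\<^bsub>?V\<^esub> s l) < \<epsilon> / (cmod c + 1)"
        using s(2)[of "\<epsilon>/(cmod c + 1)"] e c by auto
      have "vnorm ?V ((c \<odot>\<^bsub>?V\<^esub> s k) \<ominus>\<^bsub>?V\<^esub> (c \<odot>\<^bsub>?V\<^esub> s l)) < \<epsilon>" if "k \<ge> M" "l \<ge> M" for k l
      proof -
        let ?d = "s k \<ominus>\<^bsub>?V\<^esub> s l"
        have "(c \<odot>\<^bsub>?V\<^esub> s k) \<ominus>\<^bsub>?V\<^esub> (c \<odot>\<^bsub>?V\<^esub> s l) = c \<odot>\<^bsub>?V\<^esub> ?d"
          using s(1) by (simp add: V.minus_conv_smult V.smult_r_distr V.smult_assoc[symmetric] mult.commute)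
        then have "vnorm ?V ((c \<odot>\<^bsub>?V\<^esub> s k) \<ominus>\<^bsub>?V\<^esub> (c \<odot>\<^bsub>?V\<^esub> s l)) = cmod c * vnorm ?V ?d"
          using s(1) by (simp add: V.vnorm_smult)
        also have "\<dots> \<le> (cmod c + 1) * vnorm ?V ?d"
          using s(1) by (intro mult_right_mono) (simp_all add: V.vnorm_nonneg)
        also have "\<dots> < \<epsilon>" using M[OF that] c by (simp add: field_simps)
        finally show ?thesis .
      qed
      then show "\<exists>M. \<forall>k\<ge>M. \<forall>l\<ge>M. vnorm ?V ((c \<odot>\<^bsub>?V\<^esub> s k) \<ominus>\<^bsub>?V\<^esub> (c \<odot>\<^bsub>?V\<^esub> s l)) < \<epsilon>" by blast
    qed (use s in auto)
  next
    case (7 s)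
    note s = cauchy_seqsD[OF 7]
    have "Cauchy (\<lambda>k. vnorm ?V (s k))"
    proof (rule CauchyI)
      fix \<epsilon> :: real assume "\<epsilon> > 0"
      then obtain M where "\<And>k l. k \<ge> M \<Longrightarrow> l \<ge> M \<Longrightarrow> vnorm ?V (s k \<ominus>\<^bsub>?V\<^esub> s l) < \<epsilon>" using s(2) by blast
      then have "\<forall>k\<ge>M. \<forall>l\<ge>M. norm (vnorm ?V (s k) - vnorm ?V (s l)) < \<epsilon>"
        unfolding real_norm_def by (intro allI impI order.strict_trans1[OF V.vnorm_diff_le[OF s(1) s(1)]])
      then show "\<exists>M. \<forall>k\<ge>M. \<forall>l\<ge>M. norm (vnorm ?V (s k) - vnorm ?V (s l)) < \<epsilon>" ..
    qed
    then obtain l where "(\<lambda>k. vnorm ?V (s k)) \<longlonglongrightarrow> l"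
      using real_Cauchy_convergent convergent_def by blast
    then have "(\<lambda>k. complex_of_real ((vnorm ?V (s k))\<^sup>2)) \<longlonglongrightarrow> of_real (l\<^sup>2)"
      by (intro tendsto_of_real tendsto_power)
    then show ?case by blast
  next
    case (8 n) show ?case by (rule \<pi>)
  next
    case (9 g s)
    note s = cauchy_seqsD[OF 9(2)]
    have lin: "linear_map ?V ?V (rep_act \<pi> g)" and bd: "bounded_by ?V 1 (rep_act \<pi> g)"
      using \<pi> 9 by (auto simp: contractive_rep_def)
    have "vnorm ?V (rep_act \<pi> g (s k) \<ominus>\<^bsub>?V\<^esub> rep_act \<pi> g (s l)) \<le> vnorm ?V (s k \<ominus>\<^bsub>?V\<^esub> s l)" for k l
      using linear_map_minus[OF V V lin s(1)[of k] s(1)[of l]] bd s(1)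
      by (metis V.minus_closed bounded_by_def mult_1)
    with s(2) linear_mapD(1)[OF lin] s(1) show ?case
      by (intro cauchy_seqsI) (auto, meson order.strict_trans1)
  }
qed

context
  fixes G :: "('g, 'b) monoid_scheme" and \<pi> :: "('g, 'v) rep"
  assumes \<pi>: "contractive_rep G \<pi>"
begin

interpretation S: seq_ip_rep G "{f. \<exists>l. f \<longlonglongrightarrow> l}" lim "\<lambda>_. \<pi>" "cauchy_seqs (rep_space \<pi>)"
  by (rule seq_ip_rep_cauchy[OF \<pi>])

lemma contractive_cauchy_rep: "contractive_rep G (cauchy_rep \<pi>)"
  using S.contractive_seq_rep by (simp add: cauchy_rep_def cauchy_space_def)

lemma bounded_by_cauchy_rep:
  assumes "a \<in> group_algebra G" "0 \<le> C" "bounded_by (rep_space \<pi>) C (rep_ext \<pi> a)"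
  shows "bounded_by (rep_space (cauchy_rep \<pi>)) C (rep_ext (cauchy_rep \<pi>) a)"
  using S.bounded_by_seq_rep[OF assms(1,2)] assms(3) by (simp add: cauchy_rep_def cauchy_space_def)

lemma const_in_cauchy_seqs: "x \<in> carrier (rep_space \<pi>) \<Longrightarrow> (\<lambda>_. x) \<in> cauchy_seqs (rep_space \<pi>)"
  using \<pi> semi_ip.minus_self[of "rep_space \<pi>" x] semi_ip.vnorm_zero[of "rep_space \<pi>"]
  by (simp add: contractive_rep_def cauchy_seqs_def)

lemma intertwiner_const: "intertwiner G \<pi> (cauchy_rep \<pi>) (\<lambda>x _. x)"
  by (auto simp: intertwiner_def linear_map_def cauchy_rep_def seq_rep_def cauchy_space_def
      S.W_simps const_in_cauchy_seqs)

lemma norm_preserving_const: "norm_preserving (rep_space \<pi>) (rep_space (cauchy_rep \<pi>)) (\<lambda>x _. x)"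
  unfolding norm_preserving_def
proof
  fix x assume x: "x \<in> carrier (rep_space \<pi>)"
  have "(vnorm S.W (\<lambda>_. x))\<^sup>2 = (vnorm (rep_space \<pi>) x)\<^sup>2"
    using S.vnorm_W_sq[OF const_in_cauchy_seqs[OF x]] by (simp only: lim_const Re_complex_of_real)
  moreover have "0 \<le> vnorm S.W (\<lambda>_. x)"
    using const_in_cauchy_seqs[OF x]
    by (intro semi_ip.vnorm_nonneg[OF S.semi_ip_W]) (simp only: S.W_simps)
  moreover have "0 \<le> vnorm (rep_space \<pi>) x"
    using \<pi> x by (auto simp: contractive_rep_def intro: semi_ip.vnorm_nonneg)
  ultimately show "vnorm (rep_space (cauchy_rep \<pi>)) (\<lambda>_. x) = vnorm (rep_space \<pi>) x"
    by (simp add: cauchy_rep_def seq_rep_def cauchy_space_def)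
qed

text \<open>
  A class of a Cauchy sequence \<open>s\<close> is approximated by the classes of the constant sequences at
  its terms \<open>s M\<close>.
\<close>

lemma completion_embed_dense:
  "norm_closure (completion (rep_space \<pi>)) (completion_embed (rep_space \<pi>) ` carrier (rep_space \<pi>))
     = carrier (completion (rep_space \<pi>))"
proof
  let ?V = "rep_space \<pi>" and ?C = "cauchy_space (rep_space \<pi>)"
  show "norm_closure (completion ?V) (completion_embed ?V ` carrier ?V) \<subseteq> carrier (completion ?V)"
    by (auto simp: norm_closure_def)
  show "carrier (completion ?V) \<subseteq> norm_closure (completion ?V) (completion_embed ?V ` carrier ?V)"
  proof
    interpret V: semi_ip ?V using \<pi> by (simp add: contractive_rep_def)
    have CW: "?C = S.W" by (simp add: cauchy_space_def)
    interpret C: semi_ip ?C unfolding CW by (rule S.semi_ip_W)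
    fix X assume X: "X \<in> carrier (completion ?V)"
    then obtain s where s: "s \<in> cauchy_seqs ?V" "X = null_class ?C s"
      unfolding completion_def C.carrier_separation by (auto simp: CW S.W_simps)
    have "\<exists>Y\<in>completion_embed ?V ` carrier ?V. vnorm (completion ?V) (X \<ominus>\<^bsub>completion ?V\<^esub> Y) < \<epsilon>"
      if e: "\<epsilon> > 0" for \<epsilon>
    proof -
      obtain M where M: "\<And>k l. k \<ge> M \<Longrightarrow> l \<ge> M \<Longrightarrow> vnorm ?V (s k \<ominus>\<^bsub>?V\<^esub> s l) < \<epsilon>/2"
        using cauchy_seqsD(2)[OF s(1), of "\<epsilon>/2"] e by auto
      let ?c = "\<lambda>_. s M"
      have sM: "s M \<in> carrier ?V" using cauchy_seqsD(1)[OF s(1)] .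
      have car: "s \<in> carrier ?C" "?c \<in> carrier ?C"
        using s(1) const_in_cauchy_seqs[OF sM] by (simp_all add: CW S.W_simps)
      have d: "s \<ominus>\<^bsub>?C\<^esub> ?c \<in> cauchy_seqs ?V"
        using C.minus_closed[OF car] by (simp add: CW S.W_simps)
      have dk: "(s \<ominus>\<^bsub>?C\<^esub> ?c) k = s k \<ominus>\<^bsub>?V\<^esub> s M" for k
        using S.W_minus[OF s(1) const_in_cauchy_seqs[OF sM]] by (simp add: CW)
      let ?f = "\<lambda>k. (vnorm ?V ((s \<ominus>\<^bsub>?C\<^esub> ?c) k))\<^sup>2"
      obtain l where l: "(\<lambda>k. complex_of_real (?f k)) \<longlonglongrightarrow> l" using S.S_norm[OF d] by auto
      have "?f \<longlonglongrightarrow> Re l" using tendsto_Re[OF l] by simp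
      \<comment> \<open>Strict inequalities become weak in the limit, hence the bound \<open>\<epsilon>/2\<close> in place of \<open>\<epsilon>\<close>.\<close>
      then have "Re l \<le> (\<epsilon>/2)\<^sup>2"
      proof (rule tendsto_upperbound)
        show "eventually (\<lambda>k. ?f k \<le> (\<epsilon>/2)\<^sup>2) sequentially"
          using eventually_ge_at_top[of M]
        proof eventually_elim
          case (elim k)
          then show ?case unfolding dk
            using M[of k M] cauchy_seqsD(1)[OF s(1)] by (intro power_mono) (simp_all add: V.vnorm_nonneg)
        qed
      qed simp
      moreover have "(vnorm ?C (s \<ominus>\<^bsub>?C\<^esub> ?c))\<^sup>2 = Re l"
        using S.vnorm_W_sq[OF d] limI[OF l] by (simp add: CW)
      ultimately have "(vnorm ?C (s \<ominus>\<^bsub>?C\<^esub> ?c))\<^sup>2 \<le> (\<epsilon>/2)\<^sup>2" by (simp only:)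
      then have "vnorm ?C (s \<ominus>\<^bsub>?C\<^esub> ?c) \<le> \<epsilon>/2"
        by (rule power2_le_imp_le) (use e in simp)
      moreover have "X \<ominus>\<^bsub>completion ?V\<^esub> completion_embed ?V (s M) = null_class ?C (s \<ominus>\<^bsub>?C\<^esub> ?c)"
        using linear_map_minus[OF C.semi_ip_axioms C.semi_ip_separation C.null_class_linear car]
        by (simp add: s(2) completion_def completion_embed_def)
      moreover have "vnorm (completion ?V) (null_class ?C (s \<ominus>\<^bsub>?C\<^esub> ?c)) = vnorm ?C (s \<ominus>\<^bsub>?C\<^esub> ?c)"
        using C.null_class_norm_preserving C.minus_closed[OF car]
        by (simp add: norm_preserving_def completion_def)
      ultimately show ?thesis using sM e by (intro bexI[of _ "completion_embed ?V (s M)"]) auto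
    qed
    with X show "X \<in> norm_closure (completion ?V) (completion_embed ?V ` carrier ?V)"
      by (simp add: norm_closure_def)
  qed
qed

end

section \<open>Quasi-regular representations\<close>

lemma semi_ip_l2:
  assumes "finite X"
  shows "semi_ip (l2 X)"
proof -
  have "abelian_group (l2 X)"
  proof (rule abelian_groupI)
    fix \<xi> assume "\<xi> \<in> carrier (l2 X)"
    then show "\<exists>\<eta>\<in>carrier (l2 X). \<eta> \<oplus>\<^bsub>l2 X\<^esub> \<xi> = \<zero>\<^bsub>l2 X\<^esub>"
      by (intro bexI[of _ "\<lambda>x. - \<xi> x"]) (auto simp: l2_def)
  qed (auto simp: l2_def add_ac)
  then show ?thesis
  proof (rule semi_ip.intro, unfold_locales, goal_cases)
    case (9 \<xi>)
    have "0 \<le> Re (\<Sum>x\<in>X. \<xi> x * cnj (\<xi> x))"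
      unfolding Re_sum by (intro sum_nonneg) (simp add: complex_mult_cnj)
    then show ?case by (simp add: l2_def)
  qed (auto simp: l2_def algebra_simps sum.distrib sum_distrib_left fun_eq_iff)
qed

lemma vnorm_l2: "vnorm (l2 X) \<xi> = sqrt (\<Sum>x\<in>X. (cmod (\<xi> x))\<^sup>2)"
  by (simp add: vnorm_def l2_def complex_mult_cnj cmod_power2)

locale finite_index_normal = normal N G for N and G (structure) +
  assumes fin: "finite (carrier (G Mod N))"
begin

lemma coset_cases:
  assumes "x \<in> carrier (G Mod N)"
  obtains h where "h \<in> carrier G" "x = N #> h"
  using assms by (auto simp: FactGroup_def RCOSETS_def)

lemma coset_in: "h \<in> carrier G \<Longrightarrow> N #> h \<in> carrier (G Mod N)"
  by (auto simp: FactGroup_def RCOSETS_def)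

text \<open>
  Left translation takes right cosets to right cosets, since those of a normal subgroup are also left
  cosets.
\<close>

lemma translate_coset:
  assumes g: "g \<in> carrier G" and h: "h \<in> carrier G"
  shows "g <# (N #> h) = N #> (g \<otimes> h)"
proof -
  have "g <# (N #> h) = (g \<otimes> h) <# N"
    using coset_eq h lcos_m_assoc[OF subset g h] by simp
  then show ?thesis using coset_eq g h by simp
qed

lemma translate_closed: "g \<in> carrier G \<Longrightarrow> x \<in> carrier (G Mod N) \<Longrightarrow> g <# x \<in> carrier (G Mod N)"
  by (metis coset_cases coset_in m_closed translate_coset)

lemma translate_inv:
  assumes "g \<in> carrier G" "x \<in> carrier (G Mod N)"
  shows "inv g <# (g <# x) = x" "g <# (inv g <# x) = x"
proof -
  obtain h where "h \<in> carrier G" "x = N #> h" using coset_cases assms(2) .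
  then show "inv g <# (g <# x) = x" "g <# (inv g <# x) = x"
    using assms by (simp_all add: translate_coset m_assoc[symmetric])
qed

text \<open>
  Translation permutes the cosets, so it only reorders the sum that computes the norm.
\<close>

lemma contractive_quasi_regular: "contractive_rep G (quasi_regular G N)"
  unfolding contractive_rep_def
proof (intro conjI ballI)
  let ?X = "carrier (G Mod N)"
  show "semi_ip (rep_space (quasi_regular G N))"
    using semi_ip_l2[OF fin] by (simp add: quasi_regular_def)
  fix g assume g: "g \<in> carrier G"
  show "linear_map (rep_space (quasi_regular G N)) (rep_space (quasi_regular G N)) (rep_act (quasi_regular G N) g)"
    by (auto simp: linear_map_def quasi_regular_def l2_def)
  have "(\<Sum>x\<in>?X. (cmod (\<xi> (inv g <# x)))\<^sup>2) = (\<Sum>x\<in>?X. (cmod (\<xi> x))\<^sup>2)" for \<xi>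
    by (rule sum.reindex_bij_witness[of _ "\<lambda>x. g <# x" "\<lambda>x. inv g <# x"])
       (use g in \<open>auto simp: translate_inv translate_closed\<close>)
  then show "bounded_by (rep_space (quasi_regular G N)) 1 (rep_act (quasi_regular G N) g)"
    by (simp add: bounded_by_def quasi_regular_def vnorm_l2)
qed

end

text \<open>
  Composition with the projection from \<open>G/N\<close> to \<open>G/M\<close> for \<open>N \<subseteq> M\<close>, which on cosets is
  multiplication by \<open>M\<close>.  The divisor is the square root of the size of the fibre over the identity coset \<open>M\<close>.
\<close>

definition coset_pullback ::
  "('g, 'b) monoid_scheme \<Rightarrow> 'g set \<Rightarrow> 'g set \<Rightarrow> ('g set \<Rightarrow> complex) \<Rightarrow> 'g set \<Rightarrow> complex" where
  "coset_pullback G M N \<xi> x = (if x \<in> carrier (G Mod N)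
     then \<xi> (M <#>\<^bsub>G\<^esub> x) / of_real (sqrt (card {x \<in> carrier (G Mod N). M <#>\<^bsub>G\<^esub> x = M})) else 0)"

text \<open>
  The projection commutes with translation, which gives equivariance.  As translation acts
  transitively on \<open>G/M\<close>, all fibres have the size of the fibre over \<open>M\<close>; hence each value of the function is
  repeated equally often in its pullback, and the scaling restores the norm.
\<close>

lemma coset_pullback:
  fixes G (structure)
  assumes M: "finite_index_normal M G" and N: "finite_index_normal N G" and sub: "N \<subseteq> M"
  shows intertwiner_coset_pullback:
      "intertwiner G (quasi_regular G M) (quasi_regular G N) (coset_pullback G M N)"
    and norm_preserving_coset_pullback:
      "norm_preserving (rep_space (quasi_regular G M)) (rep_space (quasi_regular G N)) (coset_pullback G M N)"
proof -
  interpret M: finite_index_normal M G by fact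
  interpret N: finite_index_normal N G by fact
  let ?X = "carrier (G Mod N)" and ?Y = "carrier (G Mod M)" and ?p = "\<lambda>x. M <#> x"
  let ?F = "\<lambda>y. {x \<in> ?X. ?p x = y}"
  have "M <#> N = M"
  proof
    show "M <#> N \<subseteq> M" using sub M.m_closed by (auto simp: set_mult_def)
    show "M \<subseteq> M <#> N"
    proof
      fix x assume x: "x \<in> M"
      then have "x = x \<otimes> \<one>" using M.mem_carrier by simp
      then show "x \<in> M <#> N" using x N.one_closed unfolding set_mult_def by blast
    qed
  qed
  then have p: "?p (N #> h) = M #> h" if "h \<in> carrier G" for h
    using M.setmult_rcos_assoc[OF M.subset N.subset that] by simp
  have p_closed: "?p x \<in> ?Y" if "x \<in> ?X" for x
    using that p M.coset_in by (metis N.coset_cases)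
  have p_translate: "?p (g <# x) = g <# ?p x" if g: "g \<in> carrier G" and x: "x \<in> ?X" for g x
  proof -
    obtain h where "h \<in> carrier G" "x = N #> h" using N.coset_cases x .
    then show ?thesis using g p by (simp add: N.translate_coset M.translate_coset)
  qed
  have M_coset: "M = M #> \<one>" using M.coset_mult_one M.subset by simp
  have card_F: "card (?F y) = card (?F M)" if y: "y \<in> ?Y" for y
  proof -
    obtain h where h: "h \<in> carrier G" "y = M #> h" using M.coset_cases y .
    have hM: "h <# M = y" "inv h <# y = M"
      using M.translate_coset[OF h(1), of \<one>] M.translate_coset[of "inv h" h] h M_coset by simp_all
    have "bij_betw (\<lambda>x. h <# x) (?F M) (?F y)"
      by (rule bij_betw_byWitness[where f' = "\<lambda>x. inv h <# x"])
         (use h(1) hM in \<open>auto simp: N.translate_inv N.translate_closed p_translate\<close>)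
    then show ?thesis by (simp add: bij_betw_same_card)
  qed
  let ?q = "card (?F M)"
  have "N \<in> ?F M" using N.coset_in[of \<one>] p[of \<one>] M.coset_mult_one[OF N.subset] M_coset by simp
  then have q: "?q > 0" using N.fin by (auto simp: card_gt_0_iff)
  show "intertwiner G (quasi_regular G M) (quasi_regular G N) (coset_pullback G M N)"
    unfolding intertwiner_def
  proof (intro conjI ballI)
    show "linear_map (rep_space (quasi_regular G M)) (rep_space (quasi_regular G N)) (coset_pullback G M N)"
      by (auto simp: linear_map_def quasi_regular_def l2_def coset_pullback_def add_divide_distrib fun_eq_iff)
    fix g \<xi> assume "g \<in> carrier G"
    then show "coset_pullback G M N (rep_act (quasi_regular G M) g \<xi>) = rep_act (quasi_regular G N) g (coset_pullback G M N \<xi>)"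
      using p_closed p_translate N.translate_closed
      by (auto simp: quasi_regular_def coset_pullback_def fun_eq_iff)
  qed
  show "norm_preserving (rep_space (quasi_regular G M)) (rep_space (quasi_regular G N)) (coset_pullback G M N)"
    unfolding norm_preserving_def
  proof
    fix \<xi> :: "'a set \<Rightarrow> complex"
    have "(\<Sum>x\<in>?X. (cmod (coset_pullback G M N \<xi> x))\<^sup>2) = (\<Sum>x\<in>?X. (cmod (\<xi> (?p x)))\<^sup>2 / ?q)"
      by (intro sum.cong) (simp_all add: coset_pullback_def norm_divide power_divide)
    also have "\<dots> = (\<Sum>y\<in>?Y. \<Sum>x\<in>?F y. (cmod (\<xi> (?p x)))\<^sup>2 / ?q)"
      using p_closed by (intro sum.group[symmetric] N.fin M.fin) auto
    also have "\<dots> = (\<Sum>y\<in>?Y. (cmod (\<xi> y))\<^sup>2)"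
    proof (rule sum.cong)
      fix y assume "y \<in> ?Y"
      have "(\<Sum>x\<in>?F y. (cmod (\<xi> (?p x)))\<^sup>2 / ?q) = (\<Sum>x\<in>?F y. (cmod (\<xi> y))\<^sup>2 / ?q)"
        by (intro sum.cong) auto
      also have "\<dots> = (cmod (\<xi> y))\<^sup>2" using card_F[OF \<open>y \<in> ?Y\<close>] q by simp
      finally show "(\<Sum>x\<in>?F y. (cmod (\<xi> (?p x)))\<^sup>2 / ?q) = (cmod (\<xi> y))\<^sup>2" .
    qed simp
    finally show "vnorm (rep_space (quasi_regular G N)) (coset_pullback G M N \<xi>) = vnorm (rep_space (quasi_regular G M)) \<xi>"
      by (simp add: quasi_regular_def vnorm_l2)
  qed
qed

section \<open>The representation attached to the maximal growth function\<close>

text \<open>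
  A function on \<open>G/N\<^sub>n\<close> has support of size at most \<open>\<nu>\<^sub>n\<close>, so already \<open>k = 1\<close> admits every
  bounded sequence.
\<close>

lemma H_tilde_gamma_nu:
  assumes "\<And>n. finite (carrier (G Mod N n))"
  shows "H_tilde_gamma \<U> G N (nu G N) = carrier (H_tilde \<U> G N)"
proof -
  have "card {x. \<xi> n x \<noteq> 0} \<le> 1 * nu G N n" if "\<xi> \<in> carrier (H_tilde \<U> G N)" for \<xi> n
    unfolding nu_def mult_1
    by (rule card_mono[OF assms]) (use that in \<open>auto simp: H_tilde_def bounded_space_def seq_space_def l2_def\<close>)
  then have "carrier (H_tilde \<U> G N) \<subseteq> H_tilde_gamma \<U> G N (nu G N)"
    unfolding H_tilde_gamma_def by (intro subsetI UN_I[of 1] CollectI conjI allI) simp_all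
  moreover have "H_tilde_gamma \<U> G N (nu G N) \<subseteq> carrier (H_tilde \<U> G N)"
    unfolding H_tilde_gamma_def by blast
  ultimately show ?thesis by (rule equalityI[rotated])
qed

text \<open>
  The subspace attached to \<open>\<nu>\<close> is the closure of the image of all bounded sequences.  That image is dense in the
  completion, so nothing is cut out, and the representation is an iterated quotient of spaces of
  sequences.
\<close>

lemma pi_gamma_nu:
  assumes lam: "\<And>n. contractive_rep G (quasi_regular G (N n))"
    and fin: "\<And>n. finite (carrier (G Mod N n))" and U: "nonprincipal_ultrafilter \<U>"
  shows "pi_gamma \<U> G N (nu G N)
    = separation_rep (cauchy_rep (separation_rep (bounded_rep \<U> (\<lambda>n. quasi_regular G (N n)))))"
proof -
  let ?B = "bounded_rep \<U> (\<lambda>n. quasi_regular G (N n))" and ?H = "H_tilde \<U> G N"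
  have B: "contractive_rep G ?B" by (rule contractive_bounded_rep[OF U lam])
  have spB: "rep_space ?B = ?H"
    by (simp add: bounded_rep_def seq_rep_def H_tilde_def quasi_regular_def)
  interpret H: semi_ip ?H using B spB by (simp add: contractive_rep_def)
  have spS: "rep_space (separation_rep ?B) = separation ?H" by (simp add: separation_rep_def spB)
  have "carrier ?H <+>\<^bsub>?H\<^esub> null_space ?H = carrier ?H"
  proof
    show "carrier ?H <+>\<^bsub>?H\<^esub> null_space ?H \<subseteq> carrier ?H"
      by (auto simp: set_add_def' H.null_space_iff)
    show "carrier ?H \<subseteq> carrier ?H <+>\<^bsub>?H\<^esub> null_space ?H"
    proof
      fix \<xi> assume "\<xi> \<in> carrier ?H"
      moreover have "\<zero>\<^bsub>?H\<^esub> \<in> null_space ?H" by (simp add: H.null_space_iff)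
      moreover have "\<xi> = \<xi> \<oplus>\<^bsub>?H\<^esub> \<zero>\<^bsub>?H\<^esub>" using \<open>\<xi> \<in> carrier ?H\<close> by simp
      ultimately show "\<xi> \<in> carrier ?H <+>\<^bsub>?H\<^esub> null_space ?H" unfolding set_add_def' by blast
    qed
  qed
  then have "H_gamma \<U> G N (nu G N) = norm_closure (completion (separation ?H))
      (completion_embed (separation ?H) ` carrier (separation ?H))"
    by (simp add: H_gamma_def H_hat_def H_tilde_gamma_nu[OF fin] H.carrier_separation image_image)
  also have "\<dots> = carrier (H_hat \<U> G N)"
    using completion_embed_dense[OF contractive_separation_rep[OF B]] by (simp add: spS H_hat_def)
  finally have "pi_gamma \<U> G N (nu G N) = \<lparr>rep_space = H_hat \<U> G N, rep_act = lambda_hat \<U> G N\<rparr>"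
    by (simp add: pi_gamma_def)
  also have "\<dots> = separation_rep (cauchy_rep (separation_rep ?B))"
    by (simp add: separation_rep_def cauchy_rep_def seq_rep_def bounded_rep_def H_hat_def completion_def
        lambda_hat_def completion_map_def H_tilde_def quasi_regular_def fun_eq_iff)
  finally show ?thesis .
qed

section \<open>Weak equivalence\<close>

text \<open>
  If \<open>\<sigma>\<close> contains all \<open>\<rho> n\<close>, then its norm at \<open>a\<close> bounds all of theirs; if \<open>\<pi>\<close> is
  controlled by the \<open>\<rho> n\<close>, this bound carries over to \<open>\<pi>\<close>.
\<close>

lemma weakly_contained_via_components:
  assumes \<pi>: "contractive_rep G \<pi>" and \<sigma>: "contractive_rep G \<sigma>"
    and \<rho>: "\<And>n. contractive_rep G (\<rho> n)"
    and lower: "\<And>n. \<exists>J. intertwiner G (\<rho> n) \<sigma> J \<and> norm_preserving (rep_space (\<rho> n)) (rep_space \<sigma>) J"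
    and upper: "\<And>a C. a \<in> group_algebra G \<Longrightarrow> 0 \<le> C \<Longrightarrow>
      (\<And>n. bounded_by (rep_space (\<rho> n)) C (rep_ext (\<rho> n) a)) \<Longrightarrow> bounded_by (rep_space \<pi>) C (rep_ext \<pi> a)"
  shows "weakly_contained G \<pi> \<sigma>"
  unfolding weakly_contained_def
proof
  fix a assume a: "a \<in> group_algebra G"
  show "opnorm (rep_space \<pi>) (rep_ext \<pi> a) \<le> opnorm (rep_space \<sigma>) (rep_ext \<sigma> a)"
  proof (rule opnorm_le[OF a \<pi>])
    show nn: "0 \<le> opnorm (rep_space \<sigma>) (rep_ext \<sigma> a)" by (rule opnorm_nonneg[OF a \<sigma>])
    show "bounded_by (rep_space \<pi>) (opnorm (rep_space \<sigma>) (rep_ext \<sigma> a)) (rep_ext \<pi> a)"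
      using lower bounded_by_transfer[OF a \<rho> \<sigma> _ _ bounded_by_opnorm[OF a \<sigma>]]
      by (intro upper[OF a nn]) blast
  qed
qed

theorem theorem3p1:
  fixes G :: "('g, 'b) monoid_scheme"
    and N :: "nat \<Rightarrow> 'g set"
    and \<U> :: "nat filter"
  assumes "group G"
    and "\<And>n. N n \<lhd> G"
    and "\<And>n. finite (carrier (G Mod N n))"
    and "N 0 \<subset> carrier G"
    and "\<And>n. N (Suc n) \<subset> N n"
    and "(\<Inter>n. N n) = {\<one>\<^bsub>G\<^esub>}"
    and "nonprincipal_ultrafilter \<U>"
  shows "weakly_equivalent G (pi_gamma \<U> G N (nu G N)) (direct_sum_rep (\<lambda>n. quasi_regular G (N n)))"
proof -
  have N: "finite_index_normal (N n) G" for n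
    using assms(2,3) by (simp add: finite_index_normal_def finite_index_normal_axioms_def)
  define \<rho> where "\<rho> n = quasi_regular G (N n)" for n
  define \<beta> where "\<beta> = bounded_rep \<U> \<rho>"
  have \<rho>: "contractive_rep G (\<rho> n)" for n
    unfolding \<rho>_def by (rule finite_index_normal.contractive_quasi_regular[OF N])
  have \<beta>: "contractive_rep G \<beta>"
    unfolding \<beta>_def by (rule contractive_bounded_rep[OF assms(7) \<rho>])
  let ?s = "separation_rep \<beta>" and ?\<sigma> = "direct_sum_rep \<rho>"
  let ?c = "cauchy_rep ?s"
  let ?\<pi> = "separation_rep ?c"
  note s = contractive_separation_rep[OF \<beta>]
  note c = contractive_cauchy_rep[OF s]
  note \<pi> = contractive_separation_rep[OF c]
  note \<sigma> = contractive_direct_sum_rep[of G \<rho>, OF \<rho>]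
  have eq: "pi_gamma \<U> G N (nu G N) = ?\<pi>"
    using pi_gamma_nu[of G N, OF \<rho>[unfolded \<rho>_def] assms(3,7)] by (simp add: \<beta>_def \<rho>_def[abs_def])
  have np: "norm_preserving (rep_space \<tau>) (rep_space (separation_rep \<tau>)) (null_class (rep_space \<tau>))"
    if "contractive_rep G \<tau>" for \<tau> :: "('g, 'z) rep"
    using semi_ip.null_class_norm_preserving that by (auto simp: contractive_rep_def separation_rep_def)
  have "weakly_contained G ?\<pi> ?\<sigma>"
  proof (rule weakly_contained_via_components[OF \<pi> \<sigma> \<rho>])
    show "\<exists>J. intertwiner G (\<rho> m) ?\<sigma> J \<and> norm_preserving (rep_space (\<rho> m)) (rep_space ?\<sigma>) J" for m
      using direct_sum_inclusion[of G \<rho> m, OF \<rho>] by blast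
    show "bounded_by (rep_space ?\<pi>) C (rep_ext ?\<pi> a)"
      if "a \<in> group_algebra G" "0 \<le> C" "\<And>n. bounded_by (rep_space (\<rho> n)) C (rep_ext (\<rho> n) a)" for a C
      using that \<rho> assms(7) unfolding \<beta>_def
      by (intro bounded_by_separation bounded_by_cauchy_rep bounded_by_bounded_rep
          contractive_cauchy_rep contractive_separation_rep contractive_bounded_rep)
  qed
  moreover have "weakly_contained G ?\<sigma> ?\<pi>"
  proof (rule weakly_contained_via_components[OF \<sigma> \<pi> \<rho>])
    fix m
    \<comment> \<open>Pullbacks exist only for \<open>n \<ge> m\<close>; the zero map at the finitely many other indices keeps every component an intertwiner.\<close>
    define K where "K n \<xi> = (if m \<le> n then coset_pullback G (N m) (N n) \<xi> else \<zero>\<^bsub>rep_space (\<rho> n)\<^esub>)" for n \<xi>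
    have sub: "N n \<subseteq> N m" if "m \<le> n" for n
      using lift_Suc_antimono_le[of N, OF _ that] assms(5) by blast
    have pull: "intertwiner G (\<rho> m) (\<rho> n) (K n)" "norm_preserving (rep_space (\<rho> m)) (rep_space (\<rho> n)) (K n)"
      if "m \<le> n" for n
      using coset_pullback[OF N N sub[OF that]] that by (simp_all add: K_def[abs_def] \<rho>_def)
    have V: "semi_ip (rep_space (\<rho> n))" for n using \<rho> by (simp add: contractive_rep_def)
    interpret V: semi_ip "rep_space (\<rho> n)" for n by (rule V)
    have zero: "intertwiner G (\<rho> m) (\<rho> n) (K n)" if "\<not> m \<le> n" for n
    proof -
      have "rep_act (\<rho> n) g \<zero>\<^bsub>rep_space (\<rho> n)\<^esub> = \<zero>\<^bsub>rep_space (\<rho> n)\<^esub>" if "g \<in> carrier G" for g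
        using linear_map_zero[OF V V] \<rho>[of n] that by (auto simp: contractive_rep_def)
      then show ?thesis using that
        by (auto simp: intertwiner_def linear_map_def K_def V.smult_0_right)
    qed
    have le: "vnorm (rep_space (\<rho> n)) (K n x) \<le> vnorm (rep_space (\<rho> m)) x" if "x \<in> carrier (rep_space (\<rho> m))" for n x
      using pull(2)[of n] that V.vnorm_nonneg[OF that]
      by (cases "m \<le> n") (auto simp: norm_preserving_def K_def)
    have ev: "eventually (\<lambda>n. norm_preserving (rep_space (\<rho> m)) (rep_space (\<rho> n)) (K n)) \<U>"
      using nonprincipal_eventually_ge[OF assms(7), of m] by eventually_elim (rule pull(2))
    have it: "intertwiner G (\<rho> m) (\<rho> n) (K n)" for n using pull(1) zero by blast
    note J = bounded_rep_inclusion[of \<U> G \<rho> "\<rho> m" K, OF assms(7) \<rho> \<rho> it le ev, folded \<beta>_def]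
    note Js = intertwiner_comp[OF J(1) intertwiner_null_class[OF \<beta>]]
      norm_preserving_comp[OF J np[OF \<beta>]]
    note Jc = intertwiner_comp[OF Js(1) intertwiner_const[OF s]]
      norm_preserving_comp[OF Js norm_preserving_const[OF s]]
    show "\<exists>J. intertwiner G (\<rho> m) ?\<pi> J \<and> norm_preserving (rep_space (\<rho> m)) (rep_space ?\<pi>) J"
      using intertwiner_comp[OF Jc(1) intertwiner_null_class[OF c]]
        norm_preserving_comp[OF Jc np[OF c]] by blast
  next
    show "bounded_by (rep_space ?\<sigma>) C (rep_ext ?\<sigma> a)"
      if "a \<in> group_algebra G" "0 \<le> C" "\<And>n. bounded_by (rep_space (\<rho> n)) C (rep_ext (\<rho> n) a)" for a C
      by (rule bounded_by_direct_sum_rep[OF \<rho> that])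
  qed
  ultimately show ?thesis
    unfolding weakly_equivalent_def eq by (simp add: \<rho>_def[abs_def])
qed

end
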